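(* Let $d\ge2$, and let $X$ and $Z$ be the $d$-dimensional shift and clock operators. Let $X',Z'$ be $d\times d$ unitaries with $\det X'=\det X$, $\det Z'=\det Z$, $\|X'-X\|\le\epsilon$ and $\|Z'-Z\|\le\epsilon$. Let $V\in\mathrm{SU}(d)$ and let $\widehat{V^\dagger}\in\mathrm{SU}(d)$ be an $\epsilon$-approximate inverse of $V$, i.e. $\|\widehat{V^\dagger}-V^\dagger\|=\|\widehat{V^\dagger}V-I\|\le\epsilon$. Define $$\widetilde{V^\dagger}\equiv\left[X'^d\left(Z'\widehat{V^\dagger}V\right)\right]^{d-1}X'\left[\left(Z'\widehat{V^\dagger}V\right)^dX'\right]^{d-1}Z'\widehat{V^\dagger}.$$ Then $\|\widetilde{V^\dagger}V-I\|=\|\widetilde{V^\dagger}-V^\dagger\|=O(\epsilon^2)$. Moreover, the displayed product has length $4d^2-1$ in terms of the components $X'$, $Z'$, $V$ and $\widehat{V^\dagger}$.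
   Context: With $\omega=e^{2\pi i/d}$, the clock and shift operators are $Z=\sum_{j=0}^{d-1}\omega^j|j\rangle\langle j|$ and $X=\sum_{j=0}^{d-1}|j+1\bmod d\rangle\langle j|$. $\|\cdot\|$ is the operator norm. A quantity is $O(\epsilon^2)$ if there exist $\epsilon_*>0$ and $C>0$, depending only on $d$, such that it is at most $C\epsilon^2$ for all $\epsilon\in[0,\epsilon_* )$ and all admissible $X',Z',V,\widehat{V^\dagger}$. The length of a product is its number of factors, counted with multiplicity after expanding powers. *)

theory Defs
  imports Complex_Main "Jordan_Normal_Form.Determinant" "Jordan_Normal_Form.Schur_Decomposition"
begin

definition clock_mat :: "nat \<Rightarrow> complex mat" where
  "clock_mat d = mat d d (\<lambda>(i, j). if i = j then exp (2 * of_real pi * \<i> / of_nat d) ^ j else 0)"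

definition shift_mat :: "nat \<Rightarrow> complex mat" where
  "shift_mat d = mat d d (\<lambda>(i, j). if i = (j + 1) mod d then 1 else 0)"

definition l2_norm_vec :: "complex vec \<Rightarrow> real" where
  "l2_norm_vec v = sqrt (\<Sum>i<dim_vec v. (cmod (v $ i))\<^sup>2)"

(* The supremum is that of a nonempty set which is bounded above, so the totality
   convention for Sup on the reals plays no role. *)
definition op_norm :: "complex mat \<Rightarrow> real" where
  "op_norm A = (SUP v\<in>{v \<in> carrier_vec (dim_col A). l2_norm_vec v \<le> 1}. l2_norm_vec (A *\<^sub>v v))"

definition unitary_mats :: "nat \<Rightarrow> complex mat set" where
  "unitary_mats d = {U \<in> carrier_mat d d. U * mat_adjoint U = 1\<^sub>m d \<and> mat_adjoint U * U = 1\<^sub>m d}"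

definition special_unitary_mats :: "nat \<Rightarrow> complex mat set" where
  "special_unitary_mats d = {U \<in> unitary_mats d. det U = 1}"

(* W is the approximate inverse (written with a hat over the adjoint of V in the literature). *)
definition approx_inverse :: "real \<Rightarrow> complex mat \<Rightarrow> complex mat \<Rightarrow> bool" where
  "approx_inverse \<epsilon> W V \<longleftrightarrow> op_norm (W - mat_adjoint V) \<le> \<epsilon>"

definition admissible ::
  "nat \<Rightarrow> real \<Rightarrow> complex mat \<Rightarrow> complex mat \<Rightarrow> complex mat \<Rightarrow> complex mat \<Rightarrow> bool" where
  "admissible d \<epsilon> X' Z' V W \<longleftrightarrow>
     X' \<in> unitary_mats d \<and> Z' \<in> unitary_mats d \<and>
     det X' = det (shift_mat d) \<and> det Z' = det (clock_mat d) \<and>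
     op_norm (X' - shift_mat d) \<le> \<epsilon> \<and> op_norm (Z' - clock_mat d) \<le> \<epsilon> \<and>
     V \<in> special_unitary_mats d \<and> W \<in> special_unitary_mats d \<and> approx_inverse \<epsilon> W V"

definition refined_inverse ::
  "nat \<Rightarrow> complex mat \<Rightarrow> complex mat \<Rightarrow> complex mat \<Rightarrow> complex mat \<Rightarrow> complex mat" where
  "refined_inverse d X' Z' V W =
     (X' ^\<^sub>m d * (Z' * W * V)) ^\<^sub>m (d - 1) * X' *
     ((Z' * W * V) ^\<^sub>m d * X') ^\<^sub>m (d - 1) * Z' * W"

(* The length of a product depends on how it is written and not only on its value, so the
   displayed product is also recorded as a formal expression in four symbols, standing for
   X', Z', V and W. *)
datatype component = CompX | CompZ | CompV | CompW

datatype product_expr =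
    Factor component
  | Times product_expr product_expr  (infixl \<open>\<otimes>\<^sub>e\<close> 70)
  | Power product_expr nat  (infixr \<open>^\<^sub>e\<close> 75)

primrec factors :: "product_expr \<Rightarrow> component list" where
  "factors (Factor c) = [c]"
| "factors (a \<otimes>\<^sub>e b) = factors a @ factors b"
| "factors (a ^\<^sub>e k) = concat (replicate k (factors a))"

definition product_length :: "product_expr \<Rightarrow> nat" where
  "product_length e = length (factors e)"

fun component_mat ::
  "complex mat \<Rightarrow> complex mat \<Rightarrow> complex mat \<Rightarrow> complex mat \<Rightarrow> component \<Rightarrow> complex mat" where
  "component_mat X' Z' V W CompX = X'"
| "component_mat X' Z' V W CompZ = Z'"
| "component_mat X' Z' V W CompV = V"
| "component_mat X' Z' V W CompW = W"

definition product_value :: "nat \<Rightarrow> (component \<Rightarrow> complex mat) \<Rightarrow> product_expr \<Rightarrow> complex mat" where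
  "product_value d M e = foldr (\<lambda>c A. M c * A) (factors e) (1\<^sub>m d)"

definition refined_inverse_expr :: "nat \<Rightarrow> product_expr" where
  "refined_inverse_expr d =
     (let X = Factor CompX; Z = Factor CompZ; V = Factor CompV; W = Factor CompW in
       (X ^\<^sub>e d \<otimes>\<^sub>e (Z \<otimes>\<^sub>e W \<otimes>\<^sub>e V)) ^\<^sub>e (d - 1) \<otimes>\<^sub>e X \<otimes>\<^sub>e
       ((Z \<otimes>\<^sub>e W \<otimes>\<^sub>e V) ^\<^sub>e d \<otimes>\<^sub>e X) ^\<^sub>e (d - 1) \<otimes>\<^sub>e Z \<otimes>\<^sub>e W)"

end

theory Submission
  imports Defs "HOL-Library.Landau_Symbols" "HOL-Number_Theory.Cong" "HOL-Analysis.L2_Norm"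
begin

text \<open>
  Put \<open>A = Z' W V\<close> and \<open>B = X'\<close>, which are \<open>O(\<epsilon>)\<close>-close to the clock \<open>Z\<close> and the shift \<open>X\<close>, and write
  \<open>B\<^sup>d = 1 + P\<close>, \<open>A\<^sup>d = 1 + Q\<close>. Modulo \<open>O(\<epsilon>\<^sup>2)\<close>, expanding the product gives
  \<open>1 + (\<Sum>k<d. Z\<^sup>k P Z\<^sup>-\<^sup>k) + Z\<^sup>-\<^sup>1 (\<Sum>k<d. X\<^sup>k Q X\<^sup>-\<^sup>k) Z\<close>. Now \<open>P\<close> commutes with \<open>B\<close>, hence with \<open>X\<close>
  up to second order, so its diagonal is constant up to second order, while \<open>det (1 + P) = 1\<close>
  makes its trace \<open>O(\<epsilon>\<^sup>2)\<close>. Averaging over the conjugations by \<open>Z\<close> leaves only the diagonal of \<open>P\<close>,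
  which is therefore \<open>O(\<epsilon>\<^sup>2)\<close>. Likewise \<open>Q\<close> is diagonal up to second order with trace \<open>O(\<epsilon>\<^sup>2)\<close>, and
  averaging over the conjugations by \<open>X\<close> replaces its diagonal entries by the trace.
\<close>

section \<open>Matrix families of a given order\<close>

text \<open>\<open>e\<close> is the small parameter as a function of the data \<open>'p\<close>. It
  is complex-valued so that it shares a type with the matrix entries, and bounded so that higher
  order implies lower order.\<close>

locale mat_perturbation =
  fixes d :: nat and F :: "'p filter" and e :: "'p \<Rightarrow> complex"
  assumes e_bounded: "e \<in> O[F](\<lambda>_. 1)"
begin

text \<open>Entrywise orders suffice because the dimension is fixed. The dimension is demanded at
  every \<open>x\<close>, not merely eventually, so that matrix identities apply pointwise.\<close>

definition mat_O :: "nat \<Rightarrow> ('p \<Rightarrow> complex mat) set" where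
  "mat_O k = {M. (\<forall>x. M x \<in> carrier_mat d d) \<and>
                 (\<forall>i<d. \<forall>j<d. (\<lambda>x. M x $$ (i, j)) \<in> O[F](\<lambda>x. e x ^ k))}"

lemma mat_O_carrier: "M \<in> mat_O k \<Longrightarrow> M x \<in> carrier_mat d d"
  by (simp add: mat_O_def)

lemma mat_O_entry: "M \<in> mat_O k \<Longrightarrow> i < d \<Longrightarrow> j < d \<Longrightarrow> (\<lambda>x. M x $$ (i, j)) \<in> O[F](\<lambda>x. e x ^ k)"
  by (simp add: mat_O_def)

lemma mat_O_I:
  assumes "\<And>x. M x \<in> carrier_mat d d"
    and "\<And>i j. i < d \<Longrightarrow> j < d \<Longrightarrow> (\<lambda>x. M x $$ (i, j)) \<in> O[F](\<lambda>x. e x ^ k)"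
  shows "M \<in> mat_O k"
  using assms by (simp add: mat_O_def)

lemma bigo_e_mono:
  assumes "f \<in> O[F](\<lambda>x. e x ^ k)" "j \<le> k"
  shows "f \<in> O[F](\<lambda>x. e x ^ j)"
proof -
  have "(\<lambda>x. e x ^ (k - j)) \<in> O[F](\<lambda>x. 1 ^ (k - j))"
    using e_bounded by (rule landau_o.big_power)
  then have "(\<lambda>x. e x ^ j * e x ^ (k - j)) \<in> O[F](\<lambda>x. e x ^ j)"
    by (intro landau_o.big_1_mult) simp_all
  then have "(\<lambda>x. e x ^ k) \<in> O[F](\<lambda>x. e x ^ j)"
    using assms(2) by (simp flip: power_add)
  with assms(1) show ?thesis by (rule landau_o.big_trans)
qed

lemma mat_O_mono: "M \<in> mat_O k \<Longrightarrow> j \<le> k \<Longrightarrow> M \<in> mat_O j"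
  unfolding mat_O_def using bigo_e_mono by blast

lemma mat_O_add: "M \<in> mat_O k \<Longrightarrow> N \<in> mat_O k \<Longrightarrow> (\<lambda>x. M x + N x) \<in> mat_O k"
proof (rule mat_O_I)
  fix i j assume "M \<in> mat_O k" "N \<in> mat_O k" "i < d" "j < d"
  moreover from this have "(M x + N x) $$ (i, j) = M x $$ (i, j) + N x $$ (i, j)" for x
    using mat_O_carrier[of N k x] by simp
  ultimately show "(\<lambda>x. (M x + N x) $$ (i, j)) \<in> O[F](\<lambda>x. e x ^ k)"
    by (simp add: mat_O_entry sum_in_bigo)
qed (simp add: mat_O_carrier)

lemma mat_O_minus: "M \<in> mat_O k \<Longrightarrow> N \<in> mat_O k \<Longrightarrow> (\<lambda>x. M x - N x) \<in> mat_O k"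
proof (rule mat_O_I)
  fix i j assume "M \<in> mat_O k" "N \<in> mat_O k" "i < d" "j < d"
  moreover from this have "(M x - N x) $$ (i, j) = M x $$ (i, j) - N x $$ (i, j)" for x
    using mat_O_carrier[of N k x] by simp
  ultimately show "(\<lambda>x. (M x - N x) $$ (i, j)) \<in> O[F](\<lambda>x. e x ^ k)"
    by (simp add: mat_O_entry sum_in_bigo)
qed (simp add: mat_O_carrier minus_carrier_mat)

lemma mat_O_mult:
  assumes M: "M \<in> mat_O k" and N: "N \<in> mat_O l"
  shows "(\<lambda>x. M x * N x) \<in> mat_O (k + l)"
proof (rule mat_O_I)
  fix i j assume ij: "i < d" "j < d"
  have "(M x * N x) $$ (i, j) = (\<Sum>m<d. M x $$ (i, m) * N x $$ (m, j))" for x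
    using mat_O_carrier[OF M, of x] mat_O_carrier[OF N, of x] ij
    by (auto simp: scalar_prod_def lessThan_atLeast0 intro!: sum.cong)
  moreover have "(\<lambda>x. \<Sum>m<d. M x $$ (i, m) * N x $$ (m, j)) \<in> O[F](\<lambda>x. e x ^ (k + l))"
    unfolding power_add
    using ij by (intro big_sum_in_bigo landau_o.big_mult mat_O_entry[OF M] mat_O_entry[OF N]) auto
  ultimately show "(\<lambda>x. (M x * N x) $$ (i, j)) \<in> O[F](\<lambda>x. e x ^ (k + l))"
    by simp
qed (metis M N mat_O_carrier mult_carrier_mat)

lemma mat_O_mult': "M \<in> mat_O k \<Longrightarrow> N \<in> mat_O l \<Longrightarrow> m = k + l \<Longrightarrow> (\<lambda>x. M x * N x) \<in> mat_O m"
  using mat_O_mult by simp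

lemma mat_O_const: "C \<in> carrier_mat d d \<Longrightarrow> (\<lambda>_. C) \<in> mat_O 0"
  by (rule mat_O_I) auto

lemma mat_O_pow: "M \<in> mat_O 0 \<Longrightarrow> (\<lambda>x. M x ^\<^sub>m n) \<in> mat_O 0"
proof (induction n)
  case 0
  have "(\<lambda>x. M x ^\<^sub>m 0) = (\<lambda>_. 1\<^sub>m d)"
    using mat_O_carrier[OF 0, THEN carrier_matD(1)] by simp
  then show ?case by (simp add: mat_O_const del: pow_mat.simps)
next
  case (Suc n)
  then show ?case by (auto intro!: mat_O_mult')
qed

section \<open>Products and determinants near the identity\<close>

lemma prod_one_plus:
  assumes "finite A" "\<And>i. i \<in> A \<Longrightarrow> a i \<in> O[F](\<lambda>x. e x ^ 1)"
  shows "(\<lambda>x. (\<Prod>i\<in>A. 1 + a i x) - 1 - (\<Sum>i\<in>A. a i x)) \<in> O[F](\<lambda>x. e x ^ 2)"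
  using assms
proof (induction A rule: finite_induct)
  case (insert j A)
  let ?r = "\<lambda>x. (\<Prod>i\<in>A. 1 + a i x) - 1 - (\<Sum>i\<in>A. a i x)"
  have r: "?r \<in> O[F](\<lambda>x. e x ^ 2)"
    using insert by simp
  \<comment> \<open>Multiplying by \<open>1 + a j x\<close> adds to the remainder
    \<open>a j x\<close> times the previous product minus 1, and both of these are first
    order.\<close>
  have "(\<lambda>x. ?r x + (\<Sum>i\<in>A. a i x)) \<in> O[F](\<lambda>x. e x ^ 1)"
    using insert.prems by (intro sum_in_bigo(1) big_sum_in_bigo bigo_e_mono[OF r]) auto
  then have "(\<lambda>x. a j x * (?r x + (\<Sum>i\<in>A. a i x))) \<in> O[F](\<lambda>x. e x ^ 1 * e x ^ 1)"
    using insert.prems by (intro landau_o.big_mult) auto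
  then have "(\<lambda>x. ?r x + a j x * (?r x + (\<Sum>i\<in>A. a i x))) \<in> O[F](\<lambda>x. e x ^ 2)"
    by (intro sum_in_bigo(1) r) (simp add: power2_eq_square)
  also have "(\<lambda>x. ?r x + a j x * (?r x + (\<Sum>i\<in>A. a i x)))
     = (\<lambda>x. (\<Prod>i\<in>insert j A. 1 + a i x) - 1 - (\<Sum>i\<in>insert j A. a i x))"
    using insert.hyps by (simp add: algebra_simps)
  finally show ?case .
qed simp

text \<open>In the Leibniz expansion the identity permutation contributes the product of the
  diagonal entries. Every other permutation moves at least two points and so picks up two
  off-diagonal entries of first order.\<close>

lemma det_one_plus:
  assumes P: "P \<in> mat_O 1"
  shows "(\<lambda>x. det (1\<^sub>m d + P x) - 1 - (\<Sum>i<d. P x $$ (i, i))) \<in> O[F](\<lambda>x. e x ^ 2)"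
proof -
  let ?S = "{p. p permutes {0..<d}}"
  let ?M = "\<lambda>x. 1\<^sub>m d + P x"
  let ?t = "\<lambda>p x. signof p * (\<Prod>i = 0..<d. ?M x $$ (i, p i))"
  have entry: "?M x $$ (i, j) = (if i = j then 1 else 0) + P x $$ (i, j)" if "i < d" "j < d" for i j x
    using that mat_O_carrier[OF P, of x] by auto
  have fin: "finite ?S" by (simp add: finite_permutations)
  have id: "id \<in> ?S" by (simp add: permutes_id)
  have "det (?M x) = ?t id x + (\<Sum>p\<in>?S - {id}. ?t p x)" for x
    using mat_O_carrier[OF P, of x] sum.remove[OF fin id, of "\<lambda>p. ?t p x"]
    by (subst det_def'[of _ d]) auto
  moreover have "?t id x = (\<Prod>i<d. 1 + P x $$ (i, i))" for x
    by (auto simp: entry lessThan_atLeast0 intro!: prod.cong)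
  ultimately have eq: "det (?M x) - 1 - (\<Sum>i<d. P x $$ (i, i)) =
     ((\<Prod>i<d. 1 + P x $$ (i, i)) - 1 - (\<Sum>i<d. P x $$ (i, i))) + (\<Sum>p\<in>?S - {id}. ?t p x)" for x
    by simp
  have "?t p \<in> O[F](\<lambda>x. e x ^ 2)" if p: "p \<in> ?S - {id}" for p
  proof -
    from p have perm: "p permutes {0..<d}" and "p \<noteq> id" by auto
    then obtain i where i: "p i \<noteq> i" by (auto simp: fun_eq_iff)
    with perm have i_less: "i < d" unfolding permutes_def by auto
    have pd: "p k < d" if "k < d" for k
      using permutes_in_image[OF perm, of k] that by simp
    \<comment> \<open>Injectivity makes \<open>p i\<close> a second moved point, whose factor is
      again off-diagonal.\<close>
    have ppi: "p (p i) \<noteq> p i" using i permutes_inj[OF perm] by (auto dest: injD)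
    have O1: "(\<lambda>x. ?M x $$ (k, p k)) \<in> O[F](\<lambda>x. e x ^ 1)" if "k < d" "p k \<noteq> k" for k
      using that pd by (simp add: entry mat_O_entry[OF P, simplified])
    have O0: "(\<lambda>x. ?M x $$ (k, p k)) \<in> O[F](\<lambda>_. 1)" if "k < d" for k
      using that pd bigo_e_mono[OF mat_O_entry[OF P], of k "p k" 0]
      by (auto simp: entry intro!: sum_in_bigo)
    have "(\<lambda>x. \<Prod>k\<in>{0..<d} - {i} - {p i}. ?M x $$ (k, p k)) \<in> O[F](\<lambda>_. 1)"
      by (rule landau_o.big_prod_in_1) (auto intro: O0)
    with O1[of i] O1[of "p i"] i ppi i_less pd
    have "(\<lambda>x. ?M x $$ (i, p i) * (?M x $$ (p i, p (p i)) *
            (\<Prod>k\<in>{0..<d} - {i} - {p i}. ?M x $$ (k, p k)))) \<in> O[F](\<lambda>x. e x ^ 1 * (e x ^ 1 * 1))"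
      by (intro landau_o.big_mult) auto
    moreover have "(\<Prod>k = 0..<d. ?M x $$ (k, p k)) = ?M x $$ (i, p i) * (?M x $$ (p i, p (p i)) *
            (\<Prod>k\<in>{0..<d} - {i} - {p i}. ?M x $$ (k, p k)))" for x
      using i i_less pd by (subst prod.remove[of _ i]; (subst prod.remove[of _ "p i"])?) auto
    ultimately show ?thesis
      by (simp add: power2_eq_square)
  qed
  then have "(\<lambda>x. \<Sum>p\<in>?S - {id}. ?t p x) \<in> O[F](\<lambda>x. e x ^ 2)"
    by (rule big_sum_in_bigo)
  moreover have "(\<lambda>x. (\<Prod>i<d. 1 + P x $$ (i, i)) - 1 - (\<Sum>i<d. P x $$ (i, i))) \<in> O[F](\<lambda>x. e x ^ 2)"
    by (rule prod_one_plus) (use mat_O_entry[OF P] in auto)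
  ultimately show ?thesis
    unfolding eq by (rule sum_in_bigo(1)[rotated])
qed

end

section \<open>First-order expansion of powers\<close>

text \<open>The recursion is the product rule for \<open>Z ^\<^sub>m n * Z\<close>;
  \<open>index_pow_deriv\<close> gives the closed form. The argument \<open>d\<close> fixes the
  dimension of the zero matrix.\<close>

primrec pow_deriv :: "nat \<Rightarrow> complex mat \<Rightarrow> complex mat \<Rightarrow> nat \<Rightarrow> complex mat" where
  "pow_deriv d Z R 0 = 0\<^sub>m d d"
| "pow_deriv d Z R (Suc n) = pow_deriv d Z R n * Z + Z ^\<^sub>m n * R"

lemma pow_deriv_carrier [simp]:
  "Z \<in> carrier_mat d d \<Longrightarrow> R \<in> carrier_mat d d \<Longrightarrow> pow_deriv d Z R n \<in> carrier_mat d d"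
  by (induction n) auto

lemma mult_pow_mat: "Z \<in> carrier_mat d d \<Longrightarrow> Z * Z ^\<^sub>m n = Z ^\<^sub>m n * Z"
proof (induction n)
  case (Suc n)
  then show ?case
    by (simp add: assoc_mult_mat[of Z d d "Z ^\<^sub>m n" d Z d, symmetric])
qed simp

text \<open>The defining recursion splits off the last factor; here the first is split off, which
  isolates the summand with the increment leftmost.\<close>

lemma pow_deriv_Suc_left:
  assumes Z: "Z \<in> carrier_mat d d" and R: "R \<in> carrier_mat d d"
  shows "pow_deriv d Z R (Suc n) = R * Z ^\<^sub>m n + Z * pow_deriv d Z R n"
proof (induction n)
  case 0
  then show ?case using assms by simp
next
  case (Suc n)
  note C = pow_deriv_carrier[OF Z R, of n] pow_carrier_mat[OF Z, of n]
  have "pow_deriv d Z R (Suc (Suc n)) = (R * Z ^\<^sub>m n + Z * pow_deriv d Z R n) * Z + Z ^\<^sub>m Suc n * R"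
    using Suc by simp
  also have "Z ^\<^sub>m Suc n = Z * Z ^\<^sub>m n"
    using mult_pow_mat[OF Z] by simp
  also have "(R * Z ^\<^sub>m n + Z * pow_deriv d Z R n) * Z = R * (Z ^\<^sub>m n * Z) + Z * (pow_deriv d Z R n * Z)"
    using Z R C by (simp add: add_mult_distrib_mat[of _ d d _ _ d] assoc_mult_mat[of _ d d _ d _ d])
  finally show ?case
    using Z R C
    by (simp add: mult_add_distrib_mat[of Z d d _ d] assoc_mult_mat[of _ d d _ d _ d]
        assoc_add_mat[of _ d d] mult_carrier_mat[of _ d d _ d])
qed

lemma index_mult_mat_sum:
  assumes "A \<in> carrier_mat n m" "B \<in> carrier_mat m k" "i < n" "j < k"
  shows "(A * B) $$ (i, j) = (\<Sum>l<m. A $$ (i, l) * B $$ (l, j))"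
  using assms by (auto simp: scalar_prod_def lessThan_atLeast0 intro!: sum.cong)

text \<open>Unfolding the recursion puts the increment at each of the \<open>n\<close> positions in
  turn. Working with entries keeps the sum in the complex numbers.\<close>

lemma index_pow_deriv:
  assumes Z: "Z \<in> carrier_mat d d" and R: "R \<in> carrier_mat d d" and i: "i < d" and j: "j < d"
  shows "pow_deriv d Z R n $$ (i, j) = (\<Sum>k<n. (Z ^\<^sub>m k * R * Z ^\<^sub>m (n - Suc k)) $$ (i, j))"
  using j
proof (induction n arbitrary: j)
  case (Suc n)
  have "(pow_deriv d Z R n * Z) $$ (i, j)
      = (\<Sum>l<d. (\<Sum>k<n. (Z ^\<^sub>m k * R * Z ^\<^sub>m (n - Suc k)) $$ (i, l)) * Z $$ (l, j))"
    using Z R i Suc by (simp add: index_mult_mat_sum[of _ d d _ d] del: index_mult_mat)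
  also have "\<dots> = (\<Sum>k<n. \<Sum>l<d. (Z ^\<^sub>m k * R * Z ^\<^sub>m (n - Suc k)) $$ (i, l) * Z $$ (l, j))"
    by (subst sum.swap) (simp add: sum_distrib_right)
  also have "\<dots> = (\<Sum>k<n. (Z ^\<^sub>m k * R * Z ^\<^sub>m (n - Suc k) * Z) $$ (i, j))"
    using Z R i Suc.prems by (intro sum.cong refl index_mult_mat_sum[symmetric]) auto
  also have "\<dots> = (\<Sum>k<n. (Z ^\<^sub>m k * R * Z ^\<^sub>m (Suc n - Suc k)) $$ (i, j))"
  proof (intro sum.cong refl)
    fix k assume "k \<in> {..<n}"
    then have *: "Suc n - Suc k = Suc (n - Suc k)" by simp
    have "Z ^\<^sub>m k * R * Z ^\<^sub>m (n - Suc k) * Z = Z ^\<^sub>m k * R * (Z ^\<^sub>m (n - Suc k) * Z)"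
      using Z R by (intro assoc_mult_mat[of _ d d _ d _ d]) auto
    then show "(Z ^\<^sub>m k * R * Z ^\<^sub>m (n - Suc k) * Z) $$ (i, j)
        = (Z ^\<^sub>m k * R * Z ^\<^sub>m (Suc n - Suc k)) $$ (i, j)"
      unfolding * by simp
  qed
  finally show ?case
    using Z R i Suc.prems by (simp add: right_mult_one_mat[of _ d d] del: index_mult_mat(1))
qed (use i in simp)

text \<open>The grouping separates the leading product from two corrections, ordered as in the
  recursion of \<open>pow_deriv\<close>.\<close>

lemma add_mult_add_mat:
  fixes A B C D :: "complex mat"
  assumes "A \<in> carrier_mat d d" "B \<in> carrier_mat d d" "C \<in> carrier_mat d d" "D \<in> carrier_mat d d"
  shows "(A + B) * (C + D) = A * C + (B * (C + D) + A * D)"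
proof -
  have "(A + B) * (C + D) = (A * C + A * D) + B * (C + D)"
    using assms by (simp add: add_mult_distrib_mat[of A d d B "C + D" d] mult_add_distrib_mat[of A d d C d D])
  also have "\<dots> = A * C + (A * D + B * (C + D))"
    using assms by (intro assoc_add_mat[of _ d d]) auto
  also have "A * D + B * (C + D) = B * (C + D) + A * D"
    using assms by (intro comm_add_mat[of _ d d]) auto
  finally show ?thesis .
qed

section \<open>Congruence of matrix families modulo second order\<close>

context mat_perturbation
begin

text \<open>Boundedness of both sides is built in, which makes the relation compatible with
  products.\<close>

definition approx2 :: "('p \<Rightarrow> complex mat) \<Rightarrow> ('p \<Rightarrow> complex mat) \<Rightarrow> bool" (infix \<open>\<simeq>\<close> 50) where
  "M \<simeq> N \<longleftrightarrow> M \<in> mat_O 0 \<and> N \<in> mat_O 0 \<and> (\<lambda>x. M x - N x) \<in> mat_O 2"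

lemma mat_O_cong: "(\<And>x. M x = N x) \<Longrightarrow> N \<in> mat_O k \<Longrightarrow> M \<in> mat_O k"
  by (simp add: mat_O_def)

lemmas mat_distribs =
  add_mult_distrib_mat[of _ d d _ _ d] mult_add_distrib_mat[of _ d d _ d]
  minus_mult_distrib_mat[of _ d d _ _ d] mult_minus_distrib_mat[of _ d d _ d]
  assoc_mult_mat[of _ d d _ d _ d] mult_carrier_mat[of _ d d _ d]

lemma mat_O_zero: "(\<lambda>_. 0\<^sub>m d d) \<in> mat_O k"
  by (rule mat_O_I) auto

lemma approx2_refl: "M \<in> mat_O 0 \<Longrightarrow> M \<simeq> M"
  unfolding approx2_def
  by (auto intro!: mat_O_cong[OF _ mat_O_zero] minus_r_inv_mat dest: mat_O_carrier)

lemma approx2_sym: "M \<simeq> N \<Longrightarrow> N \<simeq> M"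
  unfolding approx2_def
proof (elim conjE, intro conjI)
  assume *: "M \<in> mat_O 0" "N \<in> mat_O 0" "(\<lambda>x. M x - N x) \<in> mat_O 2"
  show "(\<lambda>x. N x - M x) \<in> mat_O 2"
  proof (rule mat_O_I)
    fix i j assume ij: "i < d" "j < d"
    have "(\<lambda>x. - ((M x - N x) $$ (i, j))) \<in> O[F](\<lambda>x. e x ^ 2)"
      using mat_O_entry[OF *(3) ij] by simp
    moreover have "- ((M x - N x) $$ (i, j)) = (N x - M x) $$ (i, j)" for x
      using mat_O_carrier[OF *(1), of x] mat_O_carrier[OF *(2), of x] ij by simp
    ultimately show "(\<lambda>x. (N x - M x) $$ (i, j)) \<in> O[F](\<lambda>x. e x ^ 2)" by simp
  qed (simp add: mat_O_carrier[OF *(1)] minus_carrier_mat)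
qed

lemma approx2_trans [trans]: "M \<simeq> N \<Longrightarrow> N \<simeq> L \<Longrightarrow> M \<simeq> L"
  unfolding approx2_def
proof (elim conjE, intro conjI)
  assume *: "M \<in> mat_O 0" "N \<in> mat_O 0" "(\<lambda>x. M x - N x) \<in> mat_O 2"
    "L \<in> mat_O 0" "(\<lambda>x. N x - L x) \<in> mat_O 2"
  show "(\<lambda>x. M x - L x) \<in> mat_O 2"
  proof (rule mat_O_cong)
    fix x
    show "M x - L x = (M x - N x) + (N x - L x)"
      using mat_O_carrier[OF *(1), of x] mat_O_carrier[OF *(2), of x] mat_O_carrier[OF *(4), of x]
      by (intro eq_matI) auto
  qed (rule mat_O_add[OF *(3) *(5)])
qed

lemma approx2_eq_trans [trans]: "M = N \<Longrightarrow> N \<simeq> L \<Longrightarrow> M \<simeq> L"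
  and approx2_trans_eq [trans]: "M \<simeq> N \<Longrightarrow> N = L \<Longrightarrow> M \<simeq> L"
  by simp_all

lemma approx2_add: "M \<simeq> N \<Longrightarrow> M' \<simeq> N' \<Longrightarrow> (\<lambda>x. M x + M' x) \<simeq> (\<lambda>x. N x + N' x)"
  unfolding approx2_def
proof (elim conjE, intro conjI)
  assume *: "M \<in> mat_O 0" "N \<in> mat_O 0" "(\<lambda>x. M x - N x) \<in> mat_O 2"
    "M' \<in> mat_O 0" "N' \<in> mat_O 0" "(\<lambda>x. M' x - N' x) \<in> mat_O 2"
  show "(\<lambda>x. M x + M' x - (N x + N' x)) \<in> mat_O 2"
  proof (rule mat_O_cong)
    fix x
    show "M x + M' x - (N x + N' x) = (M x - N x) + (M' x - N' x)"
      using mat_O_carrier[OF *(1), of x] mat_O_carrier[OF *(2), of x]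
        mat_O_carrier[OF *(4), of x] mat_O_carrier[OF *(5), of x]
      by (intro eq_matI) auto
  qed (rule mat_O_add[OF *(3) *(6)])
qed (auto intro: mat_O_add)

lemma diff_mult:
  assumes "M \<in> carrier_mat d d" "N \<in> carrier_mat d d" "M' \<in> carrier_mat d d" "N' \<in> carrier_mat d d"
  shows "M * M' - N * N' = (M - N) * M' + N * (M' - (N' :: complex mat))"
proof (rule eq_matI)
  fix i j
  assume "i < dim_row ((M - N) * M' + N * (M' - N'))" "j < dim_col ((M - N) * M' + N * (M' - N'))"
  with assms show "(M * M' - N * N') $$ (i, j) = ((M - N) * M' + N * (M' - N')) $$ (i, j)"
    by (simp add: mat_distribs del: index_mult_mat(1))
qed (use assms in auto)

lemma mat_O_diff_mult:
  assumes "M \<in> mat_O 0" "N \<in> mat_O 0" "M' \<in> mat_O 0" "N' \<in> mat_O 0"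
    and "(\<lambda>x. M x - N x) \<in> mat_O k" "(\<lambda>x. M' x - N' x) \<in> mat_O k"
  shows "(\<lambda>x. M x * M' x - N x * N' x) \<in> mat_O k"
proof (rule mat_O_cong)
  show "(\<lambda>x. (M x - N x) * M' x + N x * (M' x - N' x)) \<in> mat_O k"
    using assms by (auto intro!: mat_O_add mat_O_mult')
qed (use assms mat_O_carrier in \<open>auto intro!: diff_mult\<close>)

lemma approx2_mult: "M \<simeq> N \<Longrightarrow> M' \<simeq> N' \<Longrightarrow> (\<lambda>x. M x * M' x) \<simeq> (\<lambda>x. N x * N' x)"
  unfolding approx2_def using mat_O_diff_mult by (auto intro: mat_O_mult')

text \<open>The error \<open>(M x - N x) * S x\<close> is a product of two first-order terms. So
  beside a first-order factor, a perturbed matrix may be replaced by its unperturbed value.\<close>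

lemma approx2_mult_left:
  assumes "M \<in> mat_O 0" "N \<in> mat_O 0" "(\<lambda>x. M x - N x) \<in> mat_O 1" "S \<in> mat_O 1"
  shows "(\<lambda>x. M x * S x) \<simeq> (\<lambda>x. N x * S x)"
  unfolding approx2_def
proof (intro conjI)
  have "(\<lambda>x. (M x - N x) * S x) \<in> mat_O 2"
    using assms by (auto intro!: mat_O_mult')
  then show "(\<lambda>x. M x * S x - N x * S x) \<in> mat_O 2"
    using assms mat_O_carrier by (subst minus_mult_distrib_mat[of _ d d _ _ d, symmetric]) auto
qed (use assms mat_O_mono[of S 1 0] in \<open>auto intro!: mat_O_mult'[of _ 0 _ 0]\<close>)

lemma approx2_mult_right:
  assumes "M \<in> mat_O 0" "N \<in> mat_O 0" "(\<lambda>x. M x - N x) \<in> mat_O 1" "S \<in> mat_O 1"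
  shows "(\<lambda>x. S x * M x) \<simeq> (\<lambda>x. S x * N x)"
  unfolding approx2_def
proof (intro conjI)
  have "(\<lambda>x. S x * (M x - N x)) \<in> mat_O 2"
    using assms by (auto intro!: mat_O_mult')
  then show "(\<lambda>x. S x * M x - S x * N x) \<in> mat_O 2"
    using assms mat_O_carrier by (subst mult_minus_distrib_mat[of _ d d _ d, symmetric]) auto
qed (use assms mat_O_mono[of S 1 0] in \<open>auto intro!: mat_O_mult'[of _ 0 _ 0]\<close>)

lemma mat_O_diff_pow:
  assumes M: "M \<in> mat_O 0" and N: "N \<in> mat_O 0" and MN: "(\<lambda>x. M x - N x) \<in> mat_O k"
  shows "(\<lambda>x. M x ^\<^sub>m n - N x ^\<^sub>m n) \<in> mat_O k"
proof (induction n)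
  case 0
  show ?case
    using mat_O_carrier[OF M, THEN carrier_matD(1)] mat_O_carrier[OF N, THEN carrier_matD(1)]
    by (intro mat_O_cong[OF _ mat_O_zero]) auto
next
  case (Suc n)
  then show ?case
    using assms by (auto intro!: mat_O_diff_mult mat_O_pow)
qed

lemma mat_O_pow_deriv:
  assumes Z: "Z \<in> carrier_mat d d" and R: "R \<in> mat_O k"
  shows "(\<lambda>x. pow_deriv d Z (R x) n) \<in> mat_O k"
proof (induction n)
  case (Suc n)
  then show ?case
    using mat_O_const[OF Z] R
    by (auto intro!: mat_O_add mat_O_mult'[of _ k "\<lambda>_. Z" 0] mat_O_mult'[of "\<lambda>_. Z ^\<^sub>m n" 0 R k] mat_O_pow)
qed (simp add: mat_O_zero)

text \<open>\<open>pow_deriv d Z\<close> is the derivative of \<open>M \<mapsto> M ^\<^sub>m n\<close> at \<open>Z\<close>; since the base point only matters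
  to first order, it also governs increments taken at a perturbation \<open>A\<close> of \<open>Z\<close>.\<close>

lemma pow_expansion:
  assumes Z: "Z \<in> carrier_mat d d"
    and A: "A \<in> mat_O 0" and AZ: "(\<lambda>x. A x - Z) \<in> mat_O 1"
    and R: "R \<in> mat_O 1"
    and M: "M \<simeq> (\<lambda>x. A x + R x)"
  shows "(\<lambda>x. M x ^\<^sub>m n) \<simeq> (\<lambda>x. A x ^\<^sub>m n + pow_deriv d Z (R x) n)"
proof (induction n)
  have M0: "M \<in> mat_O 0" using M by (simp add: approx2_def)
  case 0
  have "A x ^\<^sub>m 0 + pow_deriv d Z (R x) 0 = M x ^\<^sub>m 0" for x
    using mat_O_carrier[OF M0, of x, THEN carrier_matD(1)] mat_O_carrier[OF A, of x, THEN carrier_matD(1)]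
    by simp
  then show ?case
    using approx2_refl[OF mat_O_pow[OF M0, of 0]] by simp
next
  case (Suc n)
  let ?T = "\<lambda>x. pow_deriv d Z (R x) n"
  note Z0 = mat_O_const[OF Z]
  have R0: "R \<in> mat_O 0" using R by (rule mat_O_mono) simp
  have T: "?T \<in> mat_O 1" by (rule mat_O_pow_deriv[OF Z R])
  have T0: "?T \<in> mat_O 0" using T by (rule mat_O_mono) simp
  have An: "(\<lambda>x. A x ^\<^sub>m n) \<in> mat_O 0" using A by (rule mat_O_pow)
  \<comment> \<open>The increment leaves the base point first-order close to \<open>Z\<close>, so
    beside \<open>?T\<close> it may be replaced by \<open>Z\<close>.\<close>
  have ARZ: "(\<lambda>x. A x + R x - Z) \<in> mat_O 1"
  proof (rule mat_O_cong)
    show "A x + R x - Z = (A x - Z) + R x" for x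
      using mat_O_carrier[OF A, of x] mat_O_carrier[OF R, of x] Z by (intro eq_matI) auto
  qed (rule mat_O_add[OF AZ R])
  have "(\<lambda>x. M x ^\<^sub>m Suc n) \<simeq> (\<lambda>x. (A x ^\<^sub>m n + ?T x) * (A x + R x))"
    using approx2_mult[OF Suc M] by simp
  also have "(\<lambda>x. (A x ^\<^sub>m n + ?T x) * (A x + R x))
      = (\<lambda>x. A x ^\<^sub>m n * A x + (?T x * (A x + R x) + A x ^\<^sub>m n * R x))"
    using mat_O_carrier[OF A] mat_O_carrier[OF R] mat_O_carrier[OF T] mat_O_carrier[OF An]
    by (intro ext add_mult_add_mat)
  \<comment> \<open>The leading product stays exact. In the corrections, which are first order, the
    other factors become \<open>Z\<close> and \<open>Z ^\<^sub>m n\<close>; this reproduces the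
    recursion.\<close>
  also have "\<dots> \<simeq> (\<lambda>x. A x ^\<^sub>m n * A x + (?T x * Z + Z ^\<^sub>m n * R x))"
    by (intro approx2_add approx2_refl approx2_mult_right approx2_mult_left
        mat_O_add mat_O_mult'[of _ 0 _ 0] An A R T R0 Z0 ARZ mat_O_pow mat_O_diff_pow AZ) simp_all
  finally show ?case by simp
qed

lemma approx2_sandwich:
  assumes "M \<in> mat_O 0" "M' \<in> mat_O 0" "(\<lambda>x. M x - M' x) \<in> mat_O 1"
    and "N \<in> mat_O 0" "N' \<in> mat_O 0" "(\<lambda>x. N x - N' x) \<in> mat_O 1"
    and S: "S \<in> mat_O 1"
  shows "(\<lambda>x. M x * S x * N x) \<simeq> (\<lambda>x. M' x * S x * N' x)"
proof -
  have "(\<lambda>x. M x * S x * N x) \<simeq> (\<lambda>x. M' x * S x * N x)"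
    using assms by (intro approx2_mult approx2_mult_left approx2_refl)
  also have "\<dots> \<simeq> (\<lambda>x. M' x * S x * N' x)"
    using assms by (intro approx2_mult_right mat_O_mult'[of _ 0 _ 1]) auto
  finally show ?thesis .
qed

lemma approx2_zeroI: "M \<in> mat_O 2 \<Longrightarrow> M \<simeq> (\<lambda>_. 0\<^sub>m d d)"
  unfolding approx2_def
  using mat_O_mono[of M 2 0] mat_O_minus[of M 2 "\<lambda>_. 0\<^sub>m d d"] by (simp add: mat_O_zero)

text \<open>Once \<open>Z ^\<^sub>m d = 1\<^sub>m d\<close>, this makes
  \<open>Z ^\<^sub>m (d - 1)\<close> the two-sided inverse of \<open>Z\<close>.\<close>

lemma mult_pow_pred:
  assumes "d > 0" "Z \<in> carrier_mat d d"
  shows "Z ^\<^sub>m (d - 1) * Z = Z ^\<^sub>m d" "Z * Z ^\<^sub>m (d - 1) = Z ^\<^sub>m d"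
  using assms mult_pow_mat[of Z d "d - 1"] by (cases d; simp)+

text \<open>Modulo second order, the increments of \<open>B ^\<^sub>m d\<close> and \<open>A ^\<^sub>m d\<close> enter the product only through
  their averages over conjugation by powers of \<open>Z\<close> and \<open>X\<close>, respectively. One summand of each
  average comes from the unpaired factors \<open>B\<close> and \<open>A\<close>.\<close>

lemma interleaved_product_expansion:
  assumes d: "d > 0"
    and Z: "Z \<in> carrier_mat d d" and X: "X \<in> carrier_mat d d"
    and Zd: "Z ^\<^sub>m d = 1\<^sub>m d" and Xd: "X ^\<^sub>m d = 1\<^sub>m d"
    and A: "A \<in> mat_O 0" and AZ: "(\<lambda>x. A x - Z) \<in> mat_O 1"
    and B: "B \<in> mat_O 0" and BX: "(\<lambda>x. B x - X) \<in> mat_O 1"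
  defines "P \<equiv> \<lambda>x. B x ^\<^sub>m d - 1\<^sub>m d" and "Q \<equiv> \<lambda>x. A x ^\<^sub>m d - 1\<^sub>m d"
  shows "(\<lambda>x. (B x ^\<^sub>m d * A x) ^\<^sub>m (d - 1) * B x * (A x ^\<^sub>m d * B x) ^\<^sub>m (d - 1) * A x)
    \<simeq> (\<lambda>x. 1\<^sub>m d + pow_deriv d Z (P x * Z) d + Z ^\<^sub>m (d - 1) * pow_deriv d X (Q x * X) d * Z)"
proof -
  define n where "n = d - 1"
  have dn: "d = Suc n" using d by (simp add: n_def)
  note Z0 = mat_O_const[OF Z] and X0 = mat_O_const[OF X]
  have P: "P \<in> mat_O 1"
    unfolding P_def Xd[symmetric] by (intro mat_O_diff_pow B X0 BX)
  have Q: "Q \<in> mat_O 1"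
    unfolding Q_def Zd[symmetric] by (intro mat_O_diff_pow A Z0 AZ)
  note ZX = mult_pow_pred[OF d Z, folded n_def] mult_pow_pred[OF d X, folded n_def]
  have Ac: "A x \<in> carrier_mat d d" and Bc: "B x \<in> carrier_mat d d"
    and Pc: "P x \<in> carrier_mat d d" and Qc: "Q x \<in> carrier_mat d d" for x
    using A B P Q mat_O_carrier by auto
  have Bd: "B x ^\<^sub>m d = 1\<^sub>m d + P x" and Ad: "A x ^\<^sub>m d = 1\<^sub>m d + Q x" for x
    using Bc[of x] Ac[of x] by (auto simp: P_def Q_def intro!: eq_matI)
  \<comment> \<open>First-order parts of the two bracketed powers. Their exponent is
    \<open>n = d - 1\<close>, so each is one summand short of a full average.\<close>
  define T1 where "T1 = (\<lambda>x. pow_deriv d Z (P x * Z) n)"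
  define T2 where "T2 = (\<lambda>x. pow_deriv d X (Q x * X) n)"
  have PZ: "(\<lambda>x. P x * Z) \<in> mat_O 1" and QX: "(\<lambda>x. Q x * X) \<in> mat_O 1"
    using P Q Z0 X0 by (auto intro!: mat_O_mult'[of _ 1 _ 0])
  have T1: "T1 \<in> mat_O 1" and T2: "T2 \<in> mat_O 1"
    unfolding T1_def T2_def by (intro mat_O_pow_deriv Z X PZ QX)+
  have T1c: "T1 x \<in> carrier_mat d d" and T2c: "T2 x \<in> carrier_mat d d" for x
    using T1 T2 mat_O_carrier by auto
  have An: "(\<lambda>x. A x ^\<^sub>m n) \<in> mat_O 0" and Bn: "(\<lambda>x. B x ^\<^sub>m n) \<in> mat_O 0"
    and Zn: "(\<lambda>x. Z ^\<^sub>m n) \<in> mat_O 0"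
    using A B Z0 by (intro mat_O_pow; simp)+
  have AnZ: "(\<lambda>x. A x ^\<^sub>m n - Z ^\<^sub>m n) \<in> mat_O 1"
    by (intro mat_O_diff_pow A Z0 AZ)

  have M1: "(\<lambda>x. B x ^\<^sub>m d * A x) \<simeq> (\<lambda>x. A x + P x * Z)"
  proof -
    have "(\<lambda>x. B x ^\<^sub>m d * A x) = (\<lambda>x. A x + P x * A x)"
      using Ac Pc by (simp add: Bd add_mult_distrib_mat[of _ d d _ _ d] left_mult_one_mat[of _ d d])
    also have "\<dots> \<simeq> (\<lambda>x. A x + P x * Z)"
      by (intro approx2_add approx2_refl approx2_mult_right A P Z0 AZ)
    finally show ?thesis .
  qed
  have M2: "(\<lambda>x. A x ^\<^sub>m d * B x) \<simeq> (\<lambda>x. B x + Q x * X)"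
  proof -
    have "(\<lambda>x. A x ^\<^sub>m d * B x) = (\<lambda>x. B x + Q x * B x)"
      using Bc Qc by (simp add: Ad add_mult_distrib_mat[of _ d d _ _ d] left_mult_one_mat[of _ d d])
    also have "\<dots> \<simeq> (\<lambda>x. B x + Q x * X)"
      by (intro approx2_add approx2_refl approx2_mult_right B Q X0 BX)
    finally show ?thesis .
  qed
  \<comment> \<open>In the expansion, \<open>B x * B x ^\<^sub>m n * A x\<close> collapses to
    \<open>(1\<^sub>m d + P x) * A x\<close> beside \<open>T1 x\<close>, where only its unperturbed
    value \<open>Z\<close> matters.\<close>
  have BA: "(\<lambda>x. (1\<^sub>m d + P x) * A x) \<in> mat_O 0" "(\<lambda>x. (1\<^sub>m d + P x) * A x - Z) \<in> mat_O 1"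
  proof -
    have one: "(\<lambda>x. 1\<^sub>m d) \<in> mat_O 0" by (rule mat_O_const) simp
    show "(\<lambda>x. (1\<^sub>m d + P x) * A x) \<in> mat_O 0"
      using M1 unfolding approx2_def Bd by blast
    have "(\<lambda>x. (1\<^sub>m d + P x) - 1\<^sub>m d) \<in> mat_O 1"
    proof (rule mat_O_cong[OF _ P])
      show "1\<^sub>m d + P x - 1\<^sub>m d = P x" for x
        using Pc[of x] by (intro eq_matI) auto
    qed
    then have "(\<lambda>x. (1\<^sub>m d + P x) * A x - 1\<^sub>m d * Z) \<in> mat_O 1"
      using one P by (intro mat_O_diff_mult A Z0 AZ mat_O_add mat_O_mono[OF P]) auto
    then show "(\<lambda>x. (1\<^sub>m d + P x) * A x - Z) \<in> mat_O 1"
      using Z by simp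
  qed
  have ABZX: "(\<lambda>x. A x ^\<^sub>m n * B x - Z ^\<^sub>m n * X) \<in> mat_O 1"
    by (intro mat_O_diff_mult An Zn B X0 AnZ BX)

  \<comment> \<open>\<open>Q x\<close> commutes with \<open>A x\<close> exactly, hence with
    \<open>Z\<close> up to second order. This rewrites \<open>Q\<close> as a conjugate by
    \<open>Z\<close>, the form needed in the last term of the claim.\<close>
  have Q_conj: "Q \<simeq> (\<lambda>x. Z ^\<^sub>m n * (Q x * Z))"
  proof -
    have "Q = (\<lambda>x. Z ^\<^sub>m n * (Z * Q x))"
      using Qc Z left_mult_one_mat[OF Qc]
      by (simp add: assoc_mult_mat[of _ d d Z d _ d, symmetric] ZX Zd)
    also have "\<dots> \<simeq> (\<lambda>x. Z ^\<^sub>m n * (A x * Q x))"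
      by (intro approx2_mult approx2_refl Zn approx2_sym[OF approx2_mult_left] A Z0 AZ Q)
    also have "(\<lambda>x. A x * Q x) = (\<lambda>x. Q x * A x)"
      using Ac left_mult_one_mat[OF Ac] right_mult_one_mat[OF Ac] unfolding Q_def
      by (simp add: mat_distribs mult_pow_mat[of _ d])
    also have "(\<lambda>x. Z ^\<^sub>m n * (Q x * A x)) \<simeq> (\<lambda>x. Z ^\<^sub>m n * (Q x * Z))"
      by (intro approx2_mult approx2_refl Zn approx2_mult_right A Z0 AZ Q)
    finally show ?thesis .
  qed

  have one: "(\<lambda>_. 1\<^sub>m d) \<simeq> (\<lambda>_. 1\<^sub>m d)"
    by (intro approx2_refl mat_O_const) simp
  have APA: "(\<lambda>x. A x ^\<^sub>m n * P x * A x) \<simeq> (\<lambda>x. Z ^\<^sub>m n * P x * Z)"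
    by (rule approx2_sandwich[OF An Zn AnZ A Z0 AZ P])
  have TBA: "(\<lambda>x. T1 x * ((1\<^sub>m d + P x) * A x)) \<simeq> (\<lambda>x. T1 x * Z)"
    by (rule approx2_mult_right[OF BA(1) Z0 BA(2) T1])
  have ABTA: "(\<lambda>x. A x ^\<^sub>m n * B x * T2 x * A x) \<simeq> (\<lambda>x. Z ^\<^sub>m n * X * T2 x * Z)"
    by (rule approx2_sandwich[OF mat_O_mult'[OF An B] mat_O_mult'[OF Zn X0] ABZX A Z0 AZ T2]) simp_all
  \<comment> \<open>The cross term contains two first-order factors and drops out.\<close>
  have TBTA: "(\<lambda>x. T1 x * (B x * T2 x) * A x) \<simeq> (\<lambda>_. 0\<^sub>m d d)"
    by (rule approx2_zeroI, rule mat_O_mult'[OF mat_O_mult'[OF T1 mat_O_mult'[OF B T2 refl] refl] A]) simp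

  have "(\<lambda>x. (B x ^\<^sub>m d * A x) ^\<^sub>m n * B x * (A x ^\<^sub>m d * B x) ^\<^sub>m n * A x)
     \<simeq> (\<lambda>x. (A x ^\<^sub>m n + T1 x) * B x * (B x ^\<^sub>m n + T2 x) * A x)"
    unfolding T1_def T2_def
    by (intro approx2_mult approx2_refl pow_expansion Z X A B AZ BX PZ QX M1 M2)
  also have "(\<lambda>x. (A x ^\<^sub>m n + T1 x) * B x * (B x ^\<^sub>m n + T2 x) * A x)
     = (\<lambda>x. (1\<^sub>m d + (Q x + A x ^\<^sub>m n * P x * A x))
          + (T1 x * ((1\<^sub>m d + P x) * A x) + ((A x ^\<^sub>m n * B x) * T2 x * A x + T1 x * (B x * T2 x) * A x)))"
  proof
    fix x
    note c = Ac[of x] Bc[of x] Pc[of x] Qc[of x] T1c[of x] T2c[of x] pow_carrier_mat[OF Ac, of x n]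
      pow_carrier_mat[OF Bc, of x n]
    \<comment> \<open>After right association, \<open>B x * B x ^\<^sub>m n\<close> occurs with a
      trailing factor, hence the arbitrary \<open>C\<close>.\<close>
    have BBn: "B x * (B x ^\<^sub>m n * C) = C + P x * C" if C: "C \<in> carrier_mat d d" for C
    proof -
      have "B x * (B x ^\<^sub>m n * C) = B x * B x ^\<^sub>m n * C"
        using c C by (intro assoc_mult_mat[of _ d d _ d _ d, symmetric]) auto
      also have "B x * B x ^\<^sub>m n = 1\<^sub>m d + P x"
        using mult_pow_pred(2)[OF d Bc, of x] by (simp add: n_def Bd)
      finally show ?thesis
        using c C by (simp add: add_mult_distrib_mat[of _ d d _ _ d] left_mult_one_mat[OF C])
    qed
    have AAn: "A x ^\<^sub>m n * A x = 1\<^sub>m d + Q x"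
      using mult_pow_pred(1)[OF d Ac, of x] by (simp add: n_def Ad)
    show "(A x ^\<^sub>m n + T1 x) * B x * (B x ^\<^sub>m n + T2 x) * A x
     = (1\<^sub>m d + (Q x + A x ^\<^sub>m n * P x * A x))
          + (T1 x * ((1\<^sub>m d + P x) * A x) + ((A x ^\<^sub>m n * B x) * T2 x * A x + T1 x * (B x * T2 x) * A x))"
    proof (rule eq_matI)
      fix i j
      assume "i < dim_row ((1\<^sub>m d + (Q x + A x ^\<^sub>m n * P x * A x))
          + (T1 x * ((1\<^sub>m d + P x) * A x) + ((A x ^\<^sub>m n * B x) * T2 x * A x + T1 x * (B x * T2 x) * A x)))"
        "j < dim_col ((1\<^sub>m d + (Q x + A x ^\<^sub>m n * P x * A x))
          + (T1 x * ((1\<^sub>m d + P x) * A x) + ((A x ^\<^sub>m n * B x) * T2 x * A x + T1 x * (B x * T2 x) * A x)))"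
      then show "((A x ^\<^sub>m n + T1 x) * B x * (B x ^\<^sub>m n + T2 x) * A x) $$ (i, j)
     = ((1\<^sub>m d + (Q x + A x ^\<^sub>m n * P x * A x))
          + (T1 x * ((1\<^sub>m d + P x) * A x) + ((A x ^\<^sub>m n * B x) * T2 x * A x + T1 x * (B x * T2 x) * A x))) $$ (i, j)"
        using c by (simp add: mat_distribs BBn AAn del: index_mult_mat(1))
    qed (use c in auto)
  qed
  also have "\<dots> \<simeq> (\<lambda>x. (1\<^sub>m d + (Z ^\<^sub>m n * (Q x * Z) + Z ^\<^sub>m n * P x * Z))
          + (T1 x * Z + ((Z ^\<^sub>m n * X) * T2 x * Z + 0\<^sub>m d d)))"
    by (intro approx2_add one Q_conj APA TBA ABTA TBTA)
  also have "\<dots> = (\<lambda>x. 1\<^sub>m d + pow_deriv d Z (P x * Z) d + Z ^\<^sub>m n * pow_deriv d X (Q x * X) d * Z)"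
  proof
    fix x
    note c = Z X Pc[of x] Qc[of x] T1c[of x] T2c[of x] pow_carrier_mat[OF Z, of n] pow_carrier_mat[OF X, of n]
    \<comment> \<open>The missing summand of the average over \<open>Z\<close> is the last one; it
      arose from joining the unpaired \<open>B x\<close> with
      \<open>B x ^\<^sub>m n\<close>.\<close>
    have e1: "pow_deriv d Z (P x * Z) d = T1 x * Z + Z ^\<^sub>m n * (P x * Z)"
      by (simp add: dn T1_def)
    \<comment> \<open>Here the missing summand is the first one, so the recursion from the left is
      used; it reduces to \<open>Q x\<close> because \<open>X * X ^\<^sub>m n\<close> is the
      identity.\<close>
    have "pow_deriv d X (Q x * X) d = Q x * X * X ^\<^sub>m n + X * T2 x"
      using pow_deriv_Suc_left[OF X, of "Q x * X" n] X Qc[of x] by (simp add: dn T2_def)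
    also have "Q x * X * X ^\<^sub>m n = Q x"
      using Qc[of x] X by (simp add: assoc_mult_mat[of _ d d _ d _ d] ZX Xd)
    finally have e2: "pow_deriv d X (Q x * X) d = Q x + X * T2 x" .
    show "(1\<^sub>m d + (Z ^\<^sub>m n * (Q x * Z) + Z ^\<^sub>m n * P x * Z))
          + (T1 x * Z + ((Z ^\<^sub>m n * X) * T2 x * Z + 0\<^sub>m d d))
        = 1\<^sub>m d + pow_deriv d Z (P x * Z) d + Z ^\<^sub>m n * pow_deriv d X (Q x * X) d * Z"
      unfolding e1 e2
      by (rule eq_matI) (use c in \<open>auto simp: mat_distribs simp del: index_mult_mat(1)\<close>)
  qed
  finally show ?thesis
    by (simp add: n_def)
qed

end

section \<open>Clock and shift matrices\<close>

lemma clock_mat_carrier [simp]: "clock_mat d \<in> carrier_mat d d"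
  and shift_mat_carrier [simp]: "shift_mat d \<in> carrier_mat d d"
  by (simp_all add: clock_mat_def shift_mat_def)

definition root_unity :: "nat \<Rightarrow> complex" where
  "root_unity d = exp (2 * of_real pi * \<i> / of_nat d)"

lemma root_unity_pow: "root_unity d ^ j = cis (2 * pi * real j / real d)"
  by (simp add: root_unity_def cis_conv_exp exp_of_nat_mult[symmetric] field_simps)

lemma root_unity_pow_d: "d > 0 \<Longrightarrow> (root_unity d ^ i) ^ d = 1"
  by (subst power_mult[symmetric], subst mult.commute, subst power_mult) (simp add: root_unity_pow)

lemma root_unity_pow_inj: "i < d \<Longrightarrow> j < d \<Longrightarrow> root_unity d ^ i = root_unity d ^ j \<longleftrightarrow> i = j"
  using bij_betw_roots_unity[of d] by (auto simp: root_unity_pow bij_betw_def inj_on_def)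

section \<open>Entries of products with clock and shift powers\<close>

lemma clock_mat_mult:
  assumes "P \<in> carrier_mat d d" "i < d" "j < d"
  shows "(clock_mat d * P) $$ (i, j) = root_unity d ^ i * P $$ (i, j)"
proof -
  have "(clock_mat d * P) $$ (i, j) = (\<Sum>l<d. clock_mat d $$ (i, l) * P $$ (l, j))"
    using assms by (intro index_mult_mat_sum) auto
  also have "\<dots> = (\<Sum>l<d. if l = i then root_unity d ^ i * P $$ (i, j) else 0)"
    using assms by (intro sum.cong) (auto simp: clock_mat_def root_unity_def)
  finally show ?thesis using assms by simp
qed

lemma mult_clock_mat:
  assumes "P \<in> carrier_mat d d" "i < d" "j < d"
  shows "(P * clock_mat d) $$ (i, j) = P $$ (i, j) * root_unity d ^ j"
proof -
  have "(P * clock_mat d) $$ (i, j) = (\<Sum>l<d. P $$ (i, l) * clock_mat d $$ (l, j))"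
    using assms by (intro index_mult_mat_sum) auto
  also have "\<dots> = (\<Sum>l<d. if l = j then P $$ (i, j) * root_unity d ^ j else 0)"
    using assms by (intro sum.cong) (auto simp: clock_mat_def root_unity_def)
  finally show ?thesis using assms by simp
qed

text \<open>The cyclic predecessor is expressed by adding \<open>d - 1\<close>, which avoids
  subtraction on the natural numbers.\<close>

lemma mod_pred_iff:
  assumes "i < d" "l < (d :: nat)"
  shows "i = (l + 1) mod d \<longleftrightarrow> l = (i + (d - 1)) mod d"
proof
  assume "i = (l + 1) mod d"
  then have "(i + (d - 1)) mod d = (l + 1 + (d - 1)) mod d" by (simp add: mod_add_left_eq)
  also have "\<dots> = l" using assms by simp
  finally show "l = (i + (d - 1)) mod d" ..
next
  assume "l = (i + (d - 1)) mod d"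
  then have "(l + 1) mod d = (i + (d - 1) + 1) mod d" by (simp add: mod_Suc_eq)
  also have "\<dots> = i" using assms by simp
  finally show "i = (l + 1) mod d" ..
qed

lemma shift_mat_mult:
  assumes "P \<in> carrier_mat d d" "i < d" "j < d"
  shows "(shift_mat d * P) $$ (i, j) = P $$ ((i + (d - 1)) mod d, j)"
proof -
  have "(shift_mat d * P) $$ (i, j) = (\<Sum>l<d. shift_mat d $$ (i, l) * P $$ (l, j))"
    using assms by (intro index_mult_mat_sum) auto
  also have "\<dots> = (\<Sum>l<d. if l = (i + (d - 1)) mod d then P $$ ((i + (d - 1)) mod d, j) else 0)"
    using assms mod_pred_iff[of i d] by (intro sum.cong) (auto simp: shift_mat_def)
  finally show ?thesis using assms by simp
qed

lemma mult_shift_mat: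
  assumes "P \<in> carrier_mat d d" "i < d" "j < d"
  shows "(P * shift_mat d) $$ (i, j) = P $$ (i, (j + 1) mod d)"
proof -
  have "(P * shift_mat d) $$ (i, j) = (\<Sum>l<d. P $$ (i, l) * shift_mat d $$ (l, j))"
    using assms by (intro index_mult_mat_sum) auto
  also have "\<dots> = (\<Sum>l<d. if l = (j + 1) mod d then P $$ (i, (j + 1) mod d) else 0)"
    using assms by (intro sum.cong) (auto simp: shift_mat_def)
  finally show ?thesis using assms by simp
qed

lemma clock_mat_pow_mult:
  assumes "P \<in> carrier_mat d d" "i < d" "j < d"
  shows "(clock_mat d ^\<^sub>m k * P) $$ (i, j) = (root_unity d ^ i) ^ k * P $$ (i, j)"
  using assms
proof (induction k arbitrary: P)
  case (Suc k)
  then have "clock_mat d ^\<^sub>m Suc k * P = clock_mat d ^\<^sub>m k * (clock_mat d * P)"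
    by (simp add: assoc_mult_mat[of _ d d "clock_mat d" d P d])
  then show ?case
    using Suc.IH[of "clock_mat d * P"] clock_mat_mult[OF Suc.prems] Suc.prems
    by (simp add: mult_carrier_mat[of _ d d] del: index_mult_mat(1))
qed (simp add: left_mult_one_mat[of _ d d] clock_mat_def)

lemma mult_clock_mat_pow:
  assumes "P \<in> carrier_mat d d" "i < d" "j < d"
  shows "(P * clock_mat d ^\<^sub>m k) $$ (i, j) = P $$ (i, j) * (root_unity d ^ j) ^ k"
  using assms
proof (induction k)
  case (Suc k)
  then have "P * clock_mat d ^\<^sub>m Suc k = P * clock_mat d ^\<^sub>m k * clock_mat d"
    by (simp add: assoc_mult_mat[of P d d _ d "clock_mat d" d])
  then show ?case
    using Suc mult_clock_mat[of "P * clock_mat d ^\<^sub>m k" d i j]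
    by (simp add: mult_carrier_mat[of _ d d] del: index_mult_mat(1))
qed (simp add: right_mult_one_mat[of _ d d] clock_mat_def)

text \<open>Each left factor moves the row index back by one, that is, forward by
  \<open>d - 1\<close>, and these offsets accumulate.\<close>

lemma shift_mat_pow_mult:
  assumes "P \<in> carrier_mat d d" "i < d" "j < d"
  shows "(shift_mat d ^\<^sub>m k * P) $$ (i, j) = P $$ ((i + k * (d - 1)) mod d, j)"
  using assms
proof (induction k arbitrary: P)
  case (Suc k)
  then have "shift_mat d ^\<^sub>m Suc k * P = shift_mat d ^\<^sub>m k * (shift_mat d * P)"
    by (simp add: assoc_mult_mat[of _ d d "shift_mat d" d P d])
  then have "(shift_mat d ^\<^sub>m Suc k * P) $$ (i, j) = (shift_mat d * P) $$ ((i + k * (d - 1)) mod d, j)"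
    using Suc.IH[of "shift_mat d * P"] Suc.prems
    by (simp add: mult_carrier_mat[of _ d d] del: index_mult_mat(1))
  also have "\<dots> = P $$ (((i + k * (d - 1)) mod d + (d - 1)) mod d, j)"
    using Suc.prems by (intro shift_mat_mult) auto
  also have "((i + k * (d - 1)) mod d + (d - 1)) mod d = (i + Suc k * (d - 1)) mod d"
    by (subst mod_add_left_eq) (simp add: ac_simps)
  finally show ?case .
qed (simp add: left_mult_one_mat[of _ d d] shift_mat_def)

lemma mult_shift_mat_pow:
  assumes "P \<in> carrier_mat d d" "i < d" "j < d"
  shows "(P * shift_mat d ^\<^sub>m k) $$ (i, j) = P $$ (i, (j + k) mod d)"
  using assms(3)
proof (induction k arbitrary: j)
  case (Suc k)
  have "P * shift_mat d ^\<^sub>m Suc k = P * shift_mat d ^\<^sub>m k * shift_mat d"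
    using assms by (simp add: assoc_mult_mat[of P d d _ d "shift_mat d" d])
  then have "(P * shift_mat d ^\<^sub>m Suc k) $$ (i, j) = (P * shift_mat d ^\<^sub>m k) $$ (i, (j + 1) mod d)"
    using assms Suc.prems mult_shift_mat[of "P * shift_mat d ^\<^sub>m k" d i j]
    by (simp add: mult_carrier_mat[of _ d d] del: index_mult_mat(1))
  also have "\<dots> = P $$ (i, ((j + 1) mod d + k) mod d)"
    using assms by (intro Suc.IH) auto
  also have "((j + 1) mod d + k) mod d = (j + Suc k) mod d"
    by (subst mod_add_left_eq) simp
  finally show ?case .
qed (use assms in \<open>simp add: right_mult_one_mat[of _ d d] shift_mat_def\<close>)

section \<open>Order of clock and shift, and averages over conjugation by them\<close>

lemma clock_mat_pow_d:
  assumes "d > 0" shows "clock_mat d ^\<^sub>m d = 1\<^sub>m d"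
proof (rule eq_matI)
  fix i j assume "i < dim_row (1\<^sub>m d :: complex mat)" "j < dim_col (1\<^sub>m d :: complex mat)"
  then show "(clock_mat d ^\<^sub>m d) $$ (i, j) = 1\<^sub>m d $$ (i, j)"
    using clock_mat_pow_mult[of "1\<^sub>m d" d i j d] root_unity_pow_d[OF assms]
    by (simp add: right_mult_one_mat[of _ d d] del: index_mult_mat(1))
qed (simp_all add: clock_mat_def)

lemma shift_mat_pow_d: "shift_mat d ^\<^sub>m d = 1\<^sub>m d"
proof (rule eq_matI)
  fix i j assume "i < dim_row (1\<^sub>m d :: complex mat)" "j < dim_col (1\<^sub>m d :: complex mat)"
  then show "(shift_mat d ^\<^sub>m d) $$ (i, j) = 1\<^sub>m d $$ (i, j)"
    using mult_shift_mat_pow[of "1\<^sub>m d" d i j d]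
    by (simp add: left_mult_one_mat[of _ d d] del: index_mult_mat(1))
qed (simp_all add: shift_mat_def)

text \<open>As the clock has order dividing \<open>d\<close>, the summands are conjugates of
  \<open>P\<close> by clock powers. Conjugation scales entry \<open>(i, j)\<close> by a power of
  \<omega>^(i-j), and the geometric sum over a full period kills every off-diagonal entry.\<close>

lemma index_pow_deriv_clock:
  assumes P: "P \<in> carrier_mat d d" and ij: "i < d" "j < d"
  shows "pow_deriv d (clock_mat d) (P * clock_mat d) d $$ (i, j) = (if i = j then of_nat d * P $$ (i, i) else 0)"
proof -
  let ?a = "root_unity d ^ i" and ?b = "root_unity d ^ j"
  have d: "d > 0" using ij by simp
  have b0: "?b \<noteq> 0" by (simp add: root_unity_def)
  have "pow_deriv d (clock_mat d) (P * clock_mat d) d $$ (i, j)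
      = (\<Sum>k<d. (clock_mat d ^\<^sub>m k * (P * clock_mat d) * clock_mat d ^\<^sub>m (d - Suc k)) $$ (i, j))"
    using assms by (intro index_pow_deriv) auto
  also have "\<dots> = (\<Sum>k<d. (?a / ?b) ^ k * P $$ (i, j))"
  proof (intro sum.cong refl)
    fix k assume "k \<in> {..<d}"
    then have k: "d = Suc (d - Suc k) + k" by simp
    \<comment> \<open>The exponents add up to \<open>d\<close>, so the first two factors form the
      inverse of \<open>?b ^ k\<close>.\<close>
    have "?b * ?b ^ (d - Suc k) * ?b ^ k = ?b ^ d"
      by (subst (3) k) (simp only: power_add power_Suc)
    then have "?b * ?b ^ (d - Suc k) = 1 / ?b ^ k"
      using root_unity_pow_d[OF d, of j] b0 by (simp add: field_simps)
    moreover have "(clock_mat d ^\<^sub>m k * (P * clock_mat d) * clock_mat d ^\<^sub>m (d - Suc k)) $$ (i, j)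
        = ?a ^ k * P $$ (i, j) * (?b * ?b ^ (d - Suc k))"
      using assms by (simp add: mult_clock_mat_pow clock_mat_pow_mult mult_clock_mat
          mult_carrier_mat[of _ d d] del: index_mult_mat(1))
    ultimately show "(clock_mat d ^\<^sub>m k * (P * clock_mat d) * clock_mat d ^\<^sub>m (d - Suc k)) $$ (i, j)
        = (?a / ?b) ^ k * P $$ (i, j)"
      by (simp add: power_divide)
  qed
  also have "\<dots> = (\<Sum>k<d. (?a / ?b) ^ k) * P $$ (i, j)"
    by (simp add: sum_distrib_right)
  also have "\<dots> = (if i = j then of_nat d * P $$ (i, i) else 0)"
  proof (cases "i = j")
    case False
    then have "?a / ?b \<noteq> 1" using root_unity_pow_inj[of i d j] ij b0 by (simp add: field_simps)
    moreover have "(?a / ?b) ^ d = 1" using d by (simp add: power_divide root_unity_pow_d)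
    ultimately show ?thesis using False by (simp add: geometric_sum)
  next
    case True
    then have "?a / ?b = 1" using b0 by (metis divide_self)
    then show ?thesis using True by simp
  qed
  finally show ?thesis .
qed

text \<open>Conjugation by a shift power moves both indices back by \<open>k\<close>, so each
  summand stays on one cyclic diagonal.\<close>

lemma index_pow_deriv_shift:
  assumes P: "P \<in> carrier_mat d d" and ij: "i < d" "j < d"
  shows "pow_deriv d (shift_mat d) (P * shift_mat d) d $$ (i, j)
    = (\<Sum>k<d. P $$ ((i + (d - k)) mod d, (j + (d - k)) mod d))"
proof -
  have "pow_deriv d (shift_mat d) (P * shift_mat d) d $$ (i, j)
      = (\<Sum>k<d. (shift_mat d ^\<^sub>m k * (P * shift_mat d) * shift_mat d ^\<^sub>m (d - Suc k)) $$ (i, j))"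
    using assms by (intro index_pow_deriv) auto
  also have "\<dots> = (\<Sum>k<d. P $$ ((i + (d - k)) mod d, (j + (d - k)) mod d))"
  proof (intro sum.cong refl)
    fix k assume k: "k \<in> {..<d}"
    have "((j + (d - Suc k)) mod d + 1) mod d = (j + (d - Suc k) + 1) mod d"
      by (rule mod_add_left_eq)
    also have "j + (d - Suc k) + 1 = j + (d - k)" using k by simp
    finally have "((j + (d - Suc k)) mod d + 1) mod d = (j + (d - k)) mod d" .
    moreover have "(i + k * (d - 1)) mod d = (i + (d - k)) mod d"
    proof -
      \<comment> \<open>Both offsets represent -k modulo \<open>d\<close>; adding multiples of
        \<open>d\<close> compares them without negative numbers.\<close>
      have "k * (d - 1) + d = (d - k) + k * d"
        using k by (cases d) (auto simp: algebra_simps)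
      then have "(i + k * (d - 1)) + d = (i + (d - k)) + k * d" by simp
      then show ?thesis by (metis mod_add_self2 mod_mult_self1)
    qed
    ultimately show "(shift_mat d ^\<^sub>m k * (P * shift_mat d) * shift_mat d ^\<^sub>m (d - Suc k)) $$ (i, j)
        = P $$ ((i + (d - k)) mod d, (j + (d - k)) mod d)"
      using assms by (simp add: mult_shift_mat_pow shift_mat_pow_mult mult_shift_mat
          mult_carrier_mat[of _ d d] del: index_mult_mat(1) One_nat_def)
  qed
  finally show ?thesis .
qed

lemma mod_add_cancel_less:
  assumes "i < (d :: nat)" "j < d" "(i + m) mod d = (j + m) mod d"
  shows "i = j"
proof -
  have "[i + m = j + m] (mod d)" using assms(3) by (simp add: unique_euclidean_semiring_class.cong_def)
  then have "[i = j] (mod d)" by (simp add: cong_add_rcancel_nat)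
  then show ?thesis using assms by (simp add: unique_euclidean_semiring_class.cong_def)
qed

text \<open>The map from k to i - k modulo d is an injection of a finite set into itself, hence a
  bijection, so the terms are only reordered.\<close>

lemma sum_mod_rotate:
  fixes i d :: nat
  assumes "i < d"
  shows "(\<Sum>k<d. f ((i + (d - k)) mod d)) = (\<Sum>m<d. f m)"
proof (rule sum.reindex_bij_betw)
  let ?h = "\<lambda>k. (i + (d - k)) mod d"
  have inj: "inj_on ?h {..<d}"
  proof (rule inj_onI)
    fix k l assume kl: "k \<in> {..<d}" "l \<in> {..<d}" "?h k = ?h l"
    \<comment> \<open>Adding \<open>k + l\<close> clears both subtractions and leaves
      \<open>l\<close> on one side and \<open>k\<close> on the other, each shifted by
      \<open>i + d\<close>.\<close>
    then have "(?h k + (k + l)) mod d = (?h l + (k + l)) mod d" by simp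
    then have "(i + (d - k) + (k + l)) mod d = (i + (d - l) + (k + l)) mod d"
      by (simp only: mod_add_left_eq)
    moreover have "i + (d - k) + (k + l) = l + (i + d)" "i + (d - l) + (k + l) = k + (i + d)"
      using kl by auto
    ultimately have "(k + (i + d)) mod d = (l + (i + d)) mod d" by metis
    then show "k = l" using mod_add_cancel_less[of k d l "i + d"] kl by blast
  qed
  moreover have "?h ` {..<d} \<subseteq> {..<d}" using assms by auto
  ultimately show "bij_betw ?h {..<d} {..<d}"
    unfolding bij_betw_def using endo_inj_surj[OF finite_lessThan] by blast
qed

lemma det_pow_mat: "A \<in> carrier_mat m m \<Longrightarrow> det (A ^\<^sub>m n) = det A ^ n"
  by (induction n) (auto simp: det_mult[of _ m])

section \<open>Vanishing of the averaged increments to first order\<close>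

context mat_perturbation
begin

text \<open>The clock average keeps \<open>d\<close> times the diagonal. Commuting with the shift
  makes consecutive diagonal entries agree up to second order, so each is close to the trace divided
  by \<open>d\<close>.\<close>

lemma mat_O_pow_deriv_clock:
  assumes P: "P \<in> mat_O 1"
    and comm: "(\<lambda>x. P x * shift_mat d) \<simeq> (\<lambda>x. shift_mat d * P x)"
    and tr: "(\<lambda>x. \<Sum>i<d. P x $$ (i, i)) \<in> O[F](\<lambda>x. e x ^ 2)"
  shows "(\<lambda>x. pow_deriv d (clock_mat d) (P x * clock_mat d) d) \<in> mat_O 2"
proof (rule mat_O_I)
  have Pc: "P x \<in> carrier_mat d d" for x using P by (rule mat_O_carrier)
  show "pow_deriv d (clock_mat d) (P x * clock_mat d) d \<in> carrier_mat d d" for x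
    using Pc[of x] by (simp add: mult_carrier_mat[of _ d d])
  fix i j assume ij: "i < d" "j < d"
  have step: "(\<lambda>x. P x $$ (Suc m, Suc m) - P x $$ (m, m)) \<in> O[F](\<lambda>x. e x ^ 2)" if m: "Suc m < d" for m
  proof -
    \<comment> \<open>Just below the diagonal, the commutator with the shift compares two
      consecutive diagonal entries.\<close>
    have "(\<lambda>x. (P x * shift_mat d - shift_mat d * P x) $$ (Suc m, m)) \<in> O[F](\<lambda>x. e x ^ 2)"
      using comm m by (intro mat_O_entry) (auto simp: approx2_def)
    moreover have "(P x * shift_mat d - shift_mat d * P x) $$ (Suc m, m)
        = P x $$ (Suc m, Suc m) - P x $$ (m, m)" for x
      using m Pc[of x] mult_shift_mat[OF Pc, of "Suc m" m x] shift_mat_mult[OF Pc, of "Suc m" m x]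
      by (simp del: index_mult_mat(1) add: shift_mat_def)
    ultimately show ?thesis by simp
  qed
  have diag0: "(\<lambda>x. P x $$ (m, m) - P x $$ (0, 0)) \<in> O[F](\<lambda>x. e x ^ 2)" if "m < d" for m
    using that
  proof (induction m)
    case (Suc m)
    then have "(\<lambda>x. (P x $$ (Suc m, Suc m) - P x $$ (m, m)) + (P x $$ (m, m) - P x $$ (0, 0)))
       \<in> O[F](\<lambda>x. e x ^ 2)"
      by (intro sum_in_bigo(1) step) auto
    then show ?case by simp
  qed simp
  have "(\<lambda>x. \<Sum>m<d. P x $$ (m, m) - P x $$ (0, 0)) \<in> O[F](\<lambda>x. e x ^ 2)"
    by (intro big_sum_in_bigo diag0) simp
  \<comment> \<open>This combination of the trace with differences of diagonal entries equals
    \<open>of_nat d * P x $$ (i, i)\<close>.\<close>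
  then have "(\<lambda>x. (\<Sum>m<d. P x $$ (m, m)) - (\<Sum>m<d. P x $$ (m, m) - P x $$ (0, 0))
        + of_nat d * (P x $$ (i, i) - P x $$ (0, 0))) \<in> O[F](\<lambda>x. e x ^ 2)"
    using diag0[OF ij(1)] by (intro sum_in_bigo(1) sum_in_bigo(2)[OF tr]) simp_all
  then have "(\<lambda>x. of_nat d * P x $$ (i, i)) \<in> O[F](\<lambda>x. e x ^ 2)"
    by (simp add: sum_subtractf algebra_simps)
  then have "(\<lambda>x. P x $$ (i, i)) \<in> O[F](\<lambda>x. e x ^ 2)"
    using ij by simp
  then show "(\<lambda>x. pow_deriv d (clock_mat d) (P x * clock_mat d) d $$ (i, j)) \<in> O[F](\<lambda>x. e x ^ 2)"
    using ij by (cases "i = j") (simp_all add: index_pow_deriv_clock[OF Pc])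
qed

text \<open>The clock has distinct diagonal entries, so commuting with it forces off-diagonal
  entries to second order. The shift average then turns each diagonal entry into the trace.\<close>

lemma mat_O_pow_deriv_shift:
  assumes P: "P \<in> mat_O 1"
    and comm: "(\<lambda>x. P x * clock_mat d) \<simeq> (\<lambda>x. clock_mat d * P x)"
    and tr: "(\<lambda>x. \<Sum>i<d. P x $$ (i, i)) \<in> O[F](\<lambda>x. e x ^ 2)"
  shows "(\<lambda>x. pow_deriv d (shift_mat d) (P x * shift_mat d) d) \<in> mat_O 2"
proof (rule mat_O_I)
  have Pc: "P x \<in> carrier_mat d d" for x using P by (rule mat_O_carrier)
  show "pow_deriv d (shift_mat d) (P x * shift_mat d) d \<in> carrier_mat d d" for x
    using Pc[of x] by (simp add: mult_carrier_mat[of _ d d])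
  fix i j assume ij: "i < d" "j < d"
  have off: "(\<lambda>x. P x $$ (m, l)) \<in> O[F](\<lambda>x. e x ^ 2)" if ml: "m < d" "l < d" "m \<noteq> l" for m l
  proof -
    have "(\<lambda>x. (P x * clock_mat d - clock_mat d * P x) $$ (m, l)) \<in> O[F](\<lambda>x. e x ^ 2)"
      using comm ml by (intro mat_O_entry) (auto simp: approx2_def)
    moreover have "(P x * clock_mat d - clock_mat d * P x) $$ (m, l)
        = (root_unity d ^ l - root_unity d ^ m) * P x $$ (m, l)" for x
      using ml Pc[of x] mult_clock_mat[OF Pc, of m l x] clock_mat_mult[OF Pc, of m l x]
      by (simp del: index_mult_mat(1) add: clock_mat_def algebra_simps)
    ultimately show ?thesis using root_unity_pow_inj[of l d m] ml by simp
  qed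
  show "(\<lambda>x. pow_deriv d (shift_mat d) (P x * shift_mat d) d $$ (i, j)) \<in> O[F](\<lambda>x. e x ^ 2)"
  proof (cases "i = j")
    case True
    have "pow_deriv d (shift_mat d) (P x * shift_mat d) d $$ (i, j) = (\<Sum>m<d. P x $$ (m, m))" for x
      unfolding index_pow_deriv_shift[OF Pc ij]
      using sum_mod_rotate[OF ij(1), of "\<lambda>m. P x $$ (m, m)"] unfolding True .
    then show ?thesis using tr by simp
  next
    case False
    have "(\<lambda>x. P x $$ ((i + (d - k)) mod d, (j + (d - k)) mod d)) \<in> O[F](\<lambda>x. e x ^ 2)" for k
      using False ij mod_add_cancel_less[OF ij] by (intro off) auto
    then show ?thesis
      unfolding index_pow_deriv_shift[OF Pc ij] by (intro big_sum_in_bigo)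
  qed
qed

text \<open>\<open>P x\<close> commutes with \<open>A x\<close> exactly, hence with \<open>Z\<close>
  up to second order. Equal determinants give \<open>A x ^\<^sub>m d\<close> determinant 1, and the
  trace of \<open>P x\<close> is the first-order part of that determinant minus 1.\<close>

lemma pow_increment:
  assumes Z: "Z \<in> carrier_mat d d" and Zd: "Z ^\<^sub>m d = 1\<^sub>m d"
    and A: "A \<in> mat_O 0" and AZ: "(\<lambda>x. A x - Z) \<in> mat_O 1" and det: "\<And>x. det (A x) = det Z"
  defines "P \<equiv> \<lambda>x. A x ^\<^sub>m d - 1\<^sub>m d"
  shows "P \<in> mat_O 1" "(\<lambda>x. P x * Z) \<simeq> (\<lambda>x. Z * P x)"
    "(\<lambda>x. \<Sum>i<d. P x $$ (i, i)) \<in> O[F](\<lambda>x. e x ^ 2)"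
proof -
  note Z0 = mat_O_const[OF Z]
  have Ac: "A x \<in> carrier_mat d d" for x using A by (rule mat_O_carrier)
  show P: "P \<in> mat_O 1"
    unfolding P_def Zd[symmetric] by (intro mat_O_diff_pow A Z0 AZ)
  have "(\<lambda>x. P x * Z) \<simeq> (\<lambda>x. P x * A x)"
    by (rule approx2_sym[OF approx2_mult_right]) (intro A Z0 AZ P)+
  also have "(\<lambda>x. P x * A x) = (\<lambda>x. A x * P x)"
    using Ac left_mult_one_mat[OF Ac] right_mult_one_mat[OF Ac]
    unfolding P_def by (simp add: mat_distribs mult_pow_mat[of _ d])
  also have "\<dots> \<simeq> (\<lambda>x. Z * P x)"
    by (intro approx2_mult_left A Z0 AZ P)
  finally show "(\<lambda>x. P x * Z) \<simeq> (\<lambda>x. Z * P x)" .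
  have "1\<^sub>m d + P x = A x ^\<^sub>m d" for x
    using Ac[of x] by (auto simp: P_def intro!: eq_matI)
  then have "det (1\<^sub>m d + P x) = 1" for x
    using det_pow_mat[OF Ac, where n = d] det_pow_mat[OF Z, where n = d] Zd det by simp
  then show "(\<lambda>x. \<Sum>i<d. P x $$ (i, i)) \<in> O[F](\<lambda>x. e x ^ 2)"
    using det_one_plus[OF P] by simp
qed

text \<open>The averages are crossed: the increment of the shift power is averaged over the clock
  and vice versa. Each increment nearly commutes with the operator it came from, which is what the
  opposite average requires.\<close>

lemma interleaved_product_near_one:
  assumes d: "d > 0"
    and A: "A \<in> mat_O 0" and AZ: "(\<lambda>x. A x - clock_mat d) \<in> mat_O 1"
    and detA: "\<And>x. det (A x) = det (clock_mat d)"
    and B: "B \<in> mat_O 0" and BX: "(\<lambda>x. B x - shift_mat d) \<in> mat_O 1"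
    and detB: "\<And>x. det (B x) = det (shift_mat d)"
  shows "(\<lambda>x. (B x ^\<^sub>m d * A x) ^\<^sub>m (d - 1) * B x * (A x ^\<^sub>m d * B x) ^\<^sub>m (d - 1) * A x - 1\<^sub>m d) \<in> mat_O 2"
proof -
  let ?Z = "clock_mat d" and ?X = "shift_mat d"
  let ?P = "\<lambda>x. B x ^\<^sub>m d - 1\<^sub>m d" and ?Q = "\<lambda>x. A x ^\<^sub>m d - 1\<^sub>m d"
  have Z0: "(\<lambda>_. ?Z) \<in> mat_O 0" by (simp add: mat_O_const)
  note Zd = clock_mat_pow_d[OF d] and Xd = shift_mat_pow_d[of d]
  note P = pow_increment[OF shift_mat_carrier Xd B BX detB]
  note Q = pow_increment[OF clock_mat_carrier Zd A AZ detA]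
  have "(\<lambda>x. (B x ^\<^sub>m d * A x) ^\<^sub>m (d - 1) * B x * (A x ^\<^sub>m d * B x) ^\<^sub>m (d - 1) * A x)
    \<simeq> (\<lambda>x. 1\<^sub>m d + pow_deriv d ?Z (?P x * ?Z) d + ?Z ^\<^sub>m (d - 1) * pow_deriv d ?X (?Q x * ?X) d * ?Z)"
    by (intro interleaved_product_expansion d Zd Xd A AZ B BX clock_mat_carrier shift_mat_carrier)
  also have "\<dots> \<simeq> (\<lambda>x. 1\<^sub>m d + 0\<^sub>m d d + 0\<^sub>m d d)"
    by (intro approx2_add approx2_refl approx2_zeroI mat_O_const mat_O_pow_deriv_clock[OF P]
        mat_O_mult'[OF mat_O_mult'[OF mat_O_pow[OF Z0] mat_O_pow_deriv_shift[OF Q]] Z0]) simp_all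
  finally show ?thesis by (simp add: approx2_def)
qed

end

section \<open>Operator norm and formal products\<close>

lemma l2_norm_vec_L2_set: "l2_norm_vec v = L2_set (\<lambda>i. cmod (v $ i)) {..<dim_vec v}"
  by (simp add: l2_norm_vec_def L2_set_def)

lemma cmod_index_le_l2_norm: "i < dim_vec v \<Longrightarrow> cmod (v $ i) \<le> l2_norm_vec v"
  unfolding l2_norm_vec_L2_set by (rule member_le_L2_set) auto

text \<open>A crude bound that suffices in fixed dimension; it also shows that the supremum in
  \<open>op_norm\<close> is finite.\<close>

lemma l2_norm_mult_vec_le:
  assumes A: "A \<in> carrier_mat n m" and v: "v \<in> carrier_vec m" "l2_norm_vec v \<le> 1"
  shows "l2_norm_vec (A *\<^sub>v v) \<le> (\<Sum>i<n. \<Sum>j<m. cmod (A $$ (i, j)))"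
proof -
  have "l2_norm_vec (A *\<^sub>v v) \<le> (\<Sum>i<n. cmod ((A *\<^sub>v v) $ i))"
    using A L2_set_le_sum[of "{..<n}" "\<lambda>i. cmod ((A *\<^sub>v v) $ i)"] by (simp add: l2_norm_vec_L2_set)
  also have "\<dots> \<le> (\<Sum>i<n. \<Sum>j<m. cmod (A $$ (i, j)))"
  proof (rule sum_mono)
    fix i assume i: "i \<in> {..<n}"
    have "(A *\<^sub>v v) $ i = (\<Sum>j<m. A $$ (i, j) * v $ j)"
      using A v i by (auto simp: scalar_prod_def lessThan_atLeast0 intro!: sum.cong)
    then have "cmod ((A *\<^sub>v v) $ i) \<le> (\<Sum>j<m. cmod (A $$ (i, j) * v $ j))"
      by (simp add: norm_sum)
    also have "\<dots> \<le> (\<Sum>j<m. cmod (A $$ (i, j)))"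
    proof (rule sum_mono)
      fix j assume "j \<in> {..<m}"
      then have "cmod (v $ j) \<le> 1"
        using cmod_index_le_l2_norm[of j v] v by auto
      then show "cmod (A $$ (i, j) * v $ j) \<le> cmod (A $$ (i, j))"
        by (simp add: norm_mult mult_left_le)
    qed
    finally show "cmod ((A *\<^sub>v v) $ i) \<le> (\<Sum>j<m. cmod (A $$ (i, j)))" .
  qed
  finally show ?thesis .
qed

lemma op_norm_le_sum:
  assumes "A \<in> carrier_mat n m"
  shows "op_norm A \<le> (\<Sum>i<n. \<Sum>j<m. cmod (A $$ (i, j)))"
  unfolding op_norm_def
proof (rule cSUP_least)
  have "0\<^sub>v m \<in> {v \<in> carrier_vec (dim_col A). l2_norm_vec v \<le> 1}"
    using assms by (simp add: l2_norm_vec_def)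
  then show "{v \<in> carrier_vec (dim_col A). l2_norm_vec v \<le> 1} \<noteq> {}" by blast
qed (use assms l2_norm_mult_vec_le in auto)

text \<open>An entry is a coordinate of the image of a unit vector.\<close>

lemma cmod_index_le_op_norm:
  assumes A: "A \<in> carrier_mat n m" and ij: "i < n" "j < m"
  shows "cmod (A $$ (i, j)) \<le> op_norm A"
proof -
  have "l2_norm_vec (unit_vec m j) = L2_set (\<lambda>i. if i = j then 1 else 0) {..<m}"
    unfolding l2_norm_vec_L2_set using ij by (auto intro!: L2_set_cong)
  also have "\<dots> = 1"
    using ij by (simp add: L2_set_def if_distrib[of "\<lambda>x. x\<^sup>2"] cong: if_cong)
  finally have unit: "l2_norm_vec (unit_vec m j) = 1" .
  have "(A *\<^sub>v unit_vec m j) $ i = A $$ (i, j)"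
    using A ij by simp
  then have "cmod (A $$ (i, j)) \<le> l2_norm_vec (A *\<^sub>v unit_vec m j)"
    using cmod_index_le_l2_norm[of i "A *\<^sub>v unit_vec m j"] A ij by simp
  also have "\<dots> \<le> op_norm A"
    unfolding op_norm_def
  proof (rule cSUP_upper)
    show "bdd_above ((\<lambda>v. l2_norm_vec (A *\<^sub>v v)) ` {v \<in> carrier_vec (dim_col A). l2_norm_vec v \<le> 1})"
      using A l2_norm_mult_vec_le by (intro bdd_aboveI2) auto
  qed (use A unit in auto)
  finally show ?thesis .
qed

lemma mat_adjoint_carrier: "A \<in> carrier_mat n m \<Longrightarrow> mat_adjoint A \<in> carrier_mat m n"
  by (auto simp: mat_adjoint_def)

lemma index_mat_adjoint:
  "A \<in> carrier_mat n m \<Longrightarrow> i < m \<Longrightarrow> j < n \<Longrightarrow> mat_adjoint A $$ (i, j) = cnj (A $$ (j, i))"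
  by (auto simp: mat_adjoint_def mat_of_rows_def)

text \<open>The columns are orthonormal, so only diagonal terms survive when the squared norm is
  expanded into a triple sum.\<close>

lemma l2_norm_mult_isometry:
  assumes U: "U \<in> carrier_mat d d" "mat_adjoint U * U = 1\<^sub>m d" and v: "v \<in> carrier_vec d"
  shows "l2_norm_vec (U *\<^sub>v v) = l2_norm_vec v"
proof -
  have orth: "(\<Sum>i<d. cnj (U $$ (i, k)) * U $$ (i, j)) = (if k = j then 1 else 0)"
    if "j < d" "k < d" for j k
  proof -
    have "(mat_adjoint U * U) $$ (k, j) = (\<Sum>i<d. mat_adjoint U $$ (k, i) * U $$ (i, j))"
      using U mat_adjoint_carrier that by (intro index_mult_mat_sum) auto
    then show ?thesis
      using that U by (simp add: index_mat_adjoint[OF U(1)])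
  qed
  have "complex_of_real (\<Sum>i<d. (cmod ((U *\<^sub>v v) $ i))\<^sup>2)
      = (\<Sum>i<d. (\<Sum>j<d. U $$ (i, j) * v $ j) * cnj (\<Sum>k<d. U $$ (i, k) * v $ k))"
    unfolding of_real_sum complex_norm_square
  proof (intro sum.cong refl)
    fix i assume "i \<in> {..<d}"
    then have "(U *\<^sub>v v) $ i = (\<Sum>j<d. U $$ (i, j) * v $ j)"
      using U v by (auto simp: scalar_prod_def lessThan_atLeast0 intro!: sum.cong)
    then show "(U *\<^sub>v v) $ i * cnj ((U *\<^sub>v v) $ i)
      = (\<Sum>j<d. U $$ (i, j) * v $ j) * cnj (\<Sum>k<d. U $$ (i, k) * v $ k)" by simp
  qed
  also have "\<dots> = (\<Sum>i<d. \<Sum>j<d. \<Sum>k<d. v $ j * cnj (v $ k) * (cnj (U $$ (i, k)) * U $$ (i, j)))"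
    by (simp add: sum_product ac_simps)
  also have "\<dots> = (\<Sum>j<d. \<Sum>k<d. \<Sum>i<d. v $ j * cnj (v $ k) * (cnj (U $$ (i, k)) * U $$ (i, j)))"
    by (subst sum.swap, intro sum.cong refl sum.swap)
  also have "\<dots> = (\<Sum>j<d. \<Sum>k<d. if k = j then v $ j * cnj (v $ j) else 0)"
    by (intro sum.cong refl) (auto simp: sum_distrib_left[symmetric] orth)
  also have "\<dots> = complex_of_real (\<Sum>i<d. (cmod (v $ i))\<^sup>2)"
    unfolding of_real_sum complex_norm_square by simp
  finally have "(\<Sum>i<d. (cmod ((U *\<^sub>v v) $ i))\<^sup>2) = (\<Sum>i<d. (cmod (v $ i))\<^sup>2)"
    by (simp only: of_real_eq_iff)
  then show ?thesis
    using U v by (simp add: l2_norm_vec_def)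
qed

text \<open>A unitary maps the unit ball onto itself, so both suprema range over the same
  values.\<close>

lemma op_norm_mult_unitary:
  assumes A: "A \<in> carrier_mat n d" and U: "U \<in> unitary_mats d"
  shows "op_norm (A * U) = op_norm A"
proof -
  let ?B = "{v \<in> carrier_vec d. l2_norm_vec v \<le> 1}"
  have Uc: "U \<in> carrier_mat d d" and UU: "mat_adjoint U * U = 1\<^sub>m d" "U * mat_adjoint U = 1\<^sub>m d"
    using U by (auto simp: unitary_mats_def)
  note adj = mat_adjoint_carrier[OF Uc]
  have "(\<lambda>v. U *\<^sub>v v) ` ?B = ?B"
  proof (intro equalityI subsetI)
    fix v assume v: "v \<in> ?B"
    have "U *\<^sub>v (mat_adjoint U *\<^sub>v v) = v"
      using v by (subst assoc_mult_mat_vec[OF Uc adj, symmetric]) (auto simp: UU)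
    moreover from this have "mat_adjoint U *\<^sub>v v \<in> ?B"
      using v adj l2_norm_mult_isometry[OF Uc UU(1), of "mat_adjoint U *\<^sub>v v"] by auto
    ultimately show "v \<in> (\<lambda>v. U *\<^sub>v v) ` ?B" by (metis image_eqI)
  qed (use l2_norm_mult_isometry[OF Uc UU(1)] Uc in auto)
  then have "(\<lambda>v. l2_norm_vec (A *\<^sub>v v)) ` ?B = (\<lambda>v. l2_norm_vec (A *\<^sub>v v)) ` (\<lambda>v. U *\<^sub>v v) ` ?B"
    by simp
  also have "\<dots> = (\<lambda>v. l2_norm_vec ((A * U) *\<^sub>v v)) ` ?B"
    unfolding image_image using A Uc by (intro image_cong refl) (auto simp: assoc_mult_mat_vec)
  finally show ?thesis
    using A Uc by (simp add: op_norm_def)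
qed

lemma op_norm_minus_adjoint:
  assumes A: "A \<in> carrier_mat d d" and U: "U \<in> unitary_mats d"
  shows "op_norm (A - mat_adjoint U) = op_norm (A * U - 1\<^sub>m d)"
proof -
  have Uc: "U \<in> carrier_mat d d" and UU: "mat_adjoint U * U = 1\<^sub>m d"
    using U by (auto simp: unitary_mats_def)
  have "(A - mat_adjoint U) * U = A * U - 1\<^sub>m d"
    using A Uc mat_adjoint_carrier[OF Uc] UU by (simp add: minus_mult_distrib_mat[of _ d d _ _ d])
  then show ?thesis
    using op_norm_mult_unitary[OF minus_carrier_mat[OF mat_adjoint_carrier[OF Uc]] U] by metis
qed

section \<open>Evaluation and length of formal products\<close>

lemma product_value_carrier:
  assumes "\<And>c. M c \<in> carrier_mat d d"
  shows "product_value d M a \<in> carrier_mat d d"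
proof -
  have "foldr (\<lambda>c A. M c * A) cs (1\<^sub>m d) \<in> carrier_mat d d" for cs
    using assms by (induction cs) (auto simp: mult_carrier_mat[of _ d d])
  then show ?thesis by (simp add: product_value_def)
qed

lemma product_value_Factor:
  "M c \<in> carrier_mat d d \<Longrightarrow> product_value d M (Factor c) = M c"
  by (simp add: product_value_def right_mult_one_mat[of _ d d])

lemma product_value_Times:
  assumes M: "\<And>c. M c \<in> carrier_mat d d"
  shows "product_value d M (a \<otimes>\<^sub>e b) = product_value d M a * product_value d M b"
proof -
  \<comment> \<open>The end value of the fold is generalised from the identity to \<open>A\<close>;
    the dimension claim is carried along for associativity.\<close>
  have "foldr (\<lambda>c A. M c * A) cs A = foldr (\<lambda>c A. M c * A) cs (1\<^sub>m d) * A \<and>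
      foldr (\<lambda>c A. M c * A) cs (1\<^sub>m d) \<in> carrier_mat d d" if A: "A \<in> carrier_mat d d" for cs A
  proof (induction cs)
    case (Cons c cs)
    then show ?case
      using M[of c] A by (simp add: assoc_mult_mat[of _ d d _ d _ d] mult_carrier_mat[of _ d d])
  qed (simp add: left_mult_one_mat[OF A])
  from conjunct1[OF this[OF product_value_carrier[of M d b, OF M], of "factors a"]]
  show ?thesis by (simp add: product_value_def)
qed

lemma product_value_Power:
  assumes M: "\<And>c. M c \<in> carrier_mat d d"
  shows "product_value d M (a ^\<^sub>e k) = product_value d M a ^\<^sub>m k"
proof (induction k)
  case 0
  show ?case
    using product_value_carrier[of M d a, OF M] by (simp add: product_value_def)
next
  case (Suc k)
  \<comment> \<open>The factor list grows on the left whereas \<open>^\<^sub>m\<close> multiplies on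
    the right; a matrix commutes with its own powers.\<close>
  have "product_value d M (a ^\<^sub>e Suc k) = product_value d M (a \<otimes>\<^sub>e a ^\<^sub>e k)"
    by (simp add: product_value_def)
  also have "\<dots> = product_value d M a * product_value d M a ^\<^sub>m k"
    using Suc product_value_Times[of M d, OF M] by simp
  finally show ?case
    using mult_pow_mat[OF product_value_carrier[of M d a, OF M]] by simp
qed

text \<open>Ties the expression whose factors are counted to the matrix whose error is
  bounded.\<close>

lemma product_value_refined_inverse:
  assumes "X' \<in> carrier_mat d d" "Z' \<in> carrier_mat d d" "V \<in> carrier_mat d d" "W \<in> carrier_mat d d"
  shows "product_value d (component_mat X' Z' V W) (refined_inverse_expr d) = refined_inverse d X' Z' V W"
proof -
  have M: "component_mat X' Z' V W c \<in> carrier_mat d d" for c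
    using assms by (cases c) auto
  show ?thesis
    unfolding refined_inverse_expr_def refined_inverse_def Let_def
    by (simp add: M product_value_Times product_value_Power product_value_Factor[OF M])
qed

lemma product_length_simps:
  "product_length (Factor c) = 1"
  "product_length (a \<otimes>\<^sub>e b) = product_length a + product_length b"
  "product_length (a ^\<^sub>e k) = k * product_length a"
  by (simp_all add: product_length_def length_concat sum_list_replicate)

lemma product_length_refined_inverse:
  assumes "d > 0"
  shows "product_length (refined_inverse_expr d) = 4 * d\<^sup>2 - 1"
proof -
  \<comment> \<open>A successor removes the truncated subtractions from the count (d-1)(d+3) + 1 +
    (d-1)(3d+1) + 2.\<close>
  obtain m where "d = Suc m" using assms by (cases d) auto
  then show ?thesis
    by (simp add: refined_inverse_expr_def Let_def product_length_simps power2_eq_square algebra_simps)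
qed

text \<open>The trailing \<open>Z' * W\<close> meets \<open>V\<close> and completes one more block,
  leaving a product of the two matrices \<open>X'\<close> and \<open>Z' * W * V\<close>.\<close>

lemma refined_inverse_mult:
  assumes "X' \<in> carrier_mat d d" "Z' \<in> carrier_mat d d" "V \<in> carrier_mat d d" "W \<in> carrier_mat d d"
  shows "refined_inverse d X' Z' V W \<in> carrier_mat d d"
    and "refined_inverse d X' Z' V W * V = (X' ^\<^sub>m d * (Z' * W * V)) ^\<^sub>m (d - 1) * X' *
     ((Z' * W * V) ^\<^sub>m d * X') ^\<^sub>m (d - 1) * (Z' * W * V)"
proof -
  let ?S = "(X' ^\<^sub>m d * (Z' * W * V)) ^\<^sub>m (d - 1) * X' * ((Z' * W * V) ^\<^sub>m d * X') ^\<^sub>m (d - 1)"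
  have S: "?S \<in> carrier_mat d d"
    using assms by (intro mult_carrier_mat[of _ d d] pow_carrier_mat) auto
  show "refined_inverse d X' Z' V W \<in> carrier_mat d d"
    unfolding refined_inverse_def using assms by (intro mult_carrier_mat[OF _ assms(4)] mult_carrier_mat[OF S])
  have "T * Z' * W * V = T * (Z' * W * V)" if "T \<in> carrier_mat d d" for T
    using that assms by (simp add: assoc_mult_mat[of _ d d _ d _ d] mult_carrier_mat[of _ d d])
  from this[OF S]
  show "refined_inverse d X' Z' V W * V = ?S * (Z' * W * V)"
    by (simp add: refined_inverse_def)
qed

section \<open>Error bound uniform in the admissible data\<close>

lemma refined_inverse_error_bound:
  assumes d: "d > 0"
  shows "\<exists>C > 0. \<forall>\<epsilon> X' Z' V W. 0 \<le> \<epsilon> \<and> \<epsilon> < 1 \<and> admissible d \<epsilon> X' Z' V W \<longrightarrow>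
           op_norm (refined_inverse d X' Z' V W * V - 1\<^sub>m d) \<le> C * \<epsilon>\<^sup>2"
proof -
  \<comment> \<open>With respect to the filter \<open>top\<close>, Landau bounds are bounds uniform over all parameters. Outside
    the admissible set \<open>S\<close> the families take their unperturbed values, so that the hypotheses
    hold everywhere.\<close>
  define S where "S = {(\<epsilon> :: real, X', Z', V, W). 0 \<le> \<epsilon> \<and> \<epsilon> < 1 \<and> admissible d \<epsilon> X' Z' V W}"
  define e where "e = (\<lambda>p. if p \<in> S then complex_of_real (fst p) else 0)"
  define B where "B = (\<lambda>p. if p \<in> S then fst (snd p) else shift_mat d)"
  define Z' where "Z' = (\<lambda>p. if p \<in> S then fst (snd (snd p)) else clock_mat d)"
  \<comment> \<open>On admissible data this is \<open>W * V\<close>, within \<epsilon> of the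
    identity.\<close>
  define U where "U = (\<lambda>p. if p \<in> S then snd (snd (snd (snd p))) * fst (snd (snd (snd p))) else 1\<^sub>m d)"
  interpret mat_perturbation d Orderings.top e
  proof
    have "norm (e p) \<le> 1 * norm (1 :: complex)" for p
      by (auto simp: e_def S_def)
    then show "e \<in> O[Orderings.top](\<lambda>_. 1)"
      by (intro landau_o.bigI[of 1]) auto
  qed
  \<comment> \<open>Norm bounds become entrywise orders, with constant 1.\<close>
  have near: "(\<lambda>p. M p - N) \<in> mat_O 1" "M \<in> mat_O 0"
    if M: "\<And>p. M p \<in> carrier_mat d d" and N: "N \<in> carrier_mat d d"
      and inS: "\<And>p. p \<in> S \<Longrightarrow> op_norm (M p - N) \<le> fst p"
      and notS: "\<And>p. p \<notin> S \<Longrightarrow> M p = N" for M N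
  proof -
    have bound: "norm ((M p - N) $$ (i, j)) \<le> 1 * norm (e p ^ 1)" if ij: "i < d" "j < d" for p i j
    proof (cases "p \<in> S")
      case True
      have "norm ((M p - N) $$ (i, j)) \<le> op_norm (M p - N)"
        using M N ij by (intro cmod_index_le_op_norm[of _ d d] minus_carrier_mat) auto
      also have "\<dots> \<le> norm (e p)"
        using inS[OF True] by (simp add: e_def True)
      finally show ?thesis by simp
    qed (use N ij notS in simp)
    show *: "(\<lambda>p. M p - N) \<in> mat_O 1"
    proof (rule mat_O_I)
      show "(\<lambda>p. (M p - N) $$ (i, j)) \<in> O[Orderings.top](\<lambda>p. e p ^ 1)" if "i < d" "j < d" for i j
        by (rule landau_o.bigI[of 1]) (use bound[OF that] in auto)
    qed (use N in auto)
    show "M \<in> mat_O 0"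
    proof (rule mat_O_cong)
      show "M p = (M p - N) + N" for p
        using M[of p] N by (intro eq_matI) auto
    qed (use N in \<open>intro mat_O_add mat_O_mono[OF *] mat_O_const; simp\<close>)
  qed
  have adm: "0 \<le> \<epsilon> \<and> \<epsilon> < 1 \<and> admissible d \<epsilon> X Z V W" if "(\<epsilon>, X, Z, V, W) \<in> S" for \<epsilon> X Z V W
    using that by (simp add: S_def)
  have B: "(\<lambda>p. B p - shift_mat d) \<in> mat_O 1" "B \<in> mat_O 0"
    by (rule near; auto simp: B_def admissible_def unitary_mats_def dest!: adm)+
  have Z: "(\<lambda>p. Z' p - clock_mat d) \<in> mat_O 1" "Z' \<in> mat_O 0"
    by (rule near; auto simp: Z'_def admissible_def unitary_mats_def dest!: adm)+
  have U: "(\<lambda>p. U p - 1\<^sub>m d) \<in> mat_O 1" "U \<in> mat_O 0"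
    by (rule near; auto simp: U_def admissible_def approx_inverse_def special_unitary_mats_def
        unitary_mats_def op_norm_minus_adjoint[symmetric] mult_carrier_mat[of _ d d] dest!: adm)+
  define A where "A = (\<lambda>p. Z' p * U p)"
  have A0: "A \<in> mat_O 0"
    unfolding A_def using Z U by (auto intro!: mat_O_mult')
  have "(\<lambda>p. Z' p * U p - clock_mat d * 1\<^sub>m d) \<in> mat_O 1"
    by (intro mat_O_diff_mult Z U mat_O_const) auto
  then have AZ: "(\<lambda>p. A p - clock_mat d) \<in> mat_O 1"
    by (simp add: A_def right_mult_one_mat[of _ d d])
  \<comment> \<open>\<open>V\<close> and \<open>W\<close> have determinant 1, so the determinant is
    that of \<open>Z'\<close>.\<close>
  have detA: "det (A p) = det (clock_mat d)" for p
    using mat_O_carrier[OF Z(2), of p] mat_O_carrier[OF U(2), of p]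
    by (cases p) (auto simp: A_def Z'_def U_def det_mult[of _ d] admissible_def
        special_unitary_mats_def unitary_mats_def dest!: adm split: if_splits)
  have detB: "det (B p) = det (shift_mat d)" for p
    by (cases p) (auto simp: B_def admissible_def dest!: adm)
  define Y where "Y = (\<lambda>p. (B p ^\<^sub>m d * A p) ^\<^sub>m (d - 1) * B p * (A p ^\<^sub>m d * B p) ^\<^sub>m (d - 1) * A p - 1\<^sub>m d)"
  have Y: "Y \<in> mat_O 2"
    unfolding Y_def by (intro interleaved_product_near_one d A0 AZ detA B detB)
  \<comment> \<open>The moduli are embedded in the complex numbers to match the type of
    \<open>e\<close>. Bounding the whole entry sum yields one constant for the operator
    norm.\<close>
  have "(\<lambda>p. \<Sum>i<d. \<Sum>j<d. complex_of_real (cmod (Y p $$ (i, j)))) \<in> O[Orderings.top](\<lambda>p. e p ^ 2)"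
  proof (intro big_sum_in_bigo)
    fix i j assume "i \<in> {..<d}" "j \<in> {..<d}"
    then have "(\<lambda>p. Y p $$ (i, j)) \<in> O[Orderings.top](\<lambda>p. e p ^ 2)"
      using mat_O_entry[OF Y] by simp
    then show "(\<lambda>p. complex_of_real (cmod (Y p $$ (i, j)))) \<in> O[Orderings.top](\<lambda>p. e p ^ 2)"
      by (simp add: bigo_def)
  qed
  then obtain C where C: "C > 0"
    "\<And>p. norm (\<Sum>i<d. \<Sum>j<d. complex_of_real (cmod (Y p $$ (i, j)))) \<le> C * norm (e p ^ 2)"
    by (auto elim!: landau_o.bigE)
  show ?thesis
  proof (intro exI[of _ C] conjI allI impI C(1))
    fix \<epsilon> X Z V W
    assume *: "0 \<le> \<epsilon> \<and> \<epsilon> < 1 \<and> admissible d \<epsilon> X Z V W"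
    let ?p = "(\<epsilon>, X, Z, V, W)"
    from * have p: "?p \<in> S" by (simp add: S_def)
    from * have c: "X \<in> carrier_mat d d" "Z \<in> carrier_mat d d" "V \<in> carrier_mat d d" "W \<in> carrier_mat d d"
      by (auto simp: admissible_def special_unitary_mats_def unitary_mats_def)
    have "A ?p = Z * W * V" "B ?p = X"
      using p c by (simp_all add: A_def B_def Z'_def U_def assoc_mult_mat[of _ d d _ d _ d])
    then have eq: "refined_inverse d X Z V W * V - 1\<^sub>m d = Y ?p"
      unfolding Y_def by (simp add: refined_inverse_mult(2)[OF c])
    have "op_norm (Y ?p) \<le> (\<Sum>i<d. \<Sum>j<d. cmod (Y ?p $$ (i, j)))"
      by (rule op_norm_le_sum[OF mat_O_carrier[OF Y]])
    also have "\<dots> = norm (\<Sum>i<d. \<Sum>j<d. complex_of_real (cmod (Y ?p $$ (i, j))))"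
      by (simp add: sum_nonneg flip: of_real_sum)
    also have "\<dots> \<le> C * \<epsilon>\<^sup>2"
      using C(2)[of ?p] p * by (simp add: e_def norm_power)
    finally show "op_norm (refined_inverse d X Z V W * V - 1\<^sub>m d) \<le> C * \<epsilon>\<^sup>2"
      by (simp add: eq)
  qed
qed

theorem lemma4p3:
  fixes d :: nat
  assumes "d \<ge> 2"
  shows "(\<forall>\<epsilon> X' Z' V W. admissible d \<epsilon> X' Z' V W \<longrightarrow>
            op_norm (W - mat_adjoint V) = op_norm (W * V - 1\<^sub>m d) \<and>
            op_norm (refined_inverse d X' Z' V W * V - 1\<^sub>m d)
              = op_norm (refined_inverse d X' Z' V W - mat_adjoint V))
       \<and> (\<exists>\<epsilon>\<^sub>0 > 0. \<exists>C > 0. \<forall>\<epsilon>. 0 \<le> \<epsilon> \<and> \<epsilon> < \<epsilon>\<^sub>0 \<longrightarrow>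
            (\<forall>X' Z' V W. admissible d \<epsilon> X' Z' V W \<longrightarrow>
               op_norm (refined_inverse d X' Z' V W * V - 1\<^sub>m d) \<le> C * \<epsilon>\<^sup>2))
       \<and> (\<forall>\<epsilon> X' Z' V W. admissible d \<epsilon> X' Z' V W \<longrightarrow>
            product_value d (component_mat X' Z' V W) (refined_inverse_expr d)
              = refined_inverse d X' Z' V W)
       \<and> product_length (refined_inverse_expr d) = 4 * d\<^sup>2 - 1"
proof (intro conjI allI impI)
  fix \<epsilon> X' Z' V W
  assume adm: "admissible d \<epsilon> X' Z' V W"
  then have c: "X' \<in> carrier_mat d d" "Z' \<in> carrier_mat d d" "V \<in> carrier_mat d d" "W \<in> carrier_mat d d"
    and V: "V \<in> unitary_mats d"
    by (auto simp: admissible_def special_unitary_mats_def unitary_mats_def)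
  show "op_norm (W - mat_adjoint V) = op_norm (W * V - 1\<^sub>m d)"
    by (rule op_norm_minus_adjoint[OF c(4) V])
  show "op_norm (refined_inverse d X' Z' V W * V - 1\<^sub>m d)
      = op_norm (refined_inverse d X' Z' V W - mat_adjoint V)"
    by (rule op_norm_minus_adjoint[OF refined_inverse_mult(1)[OF c] V, symmetric])
  show "product_value d (component_mat X' Z' V W) (refined_inverse_expr d) = refined_inverse d X' Z' V W"
    by (rule product_value_refined_inverse[OF c])
next
  show "product_length (refined_inverse_expr d) = 4 * d\<^sup>2 - 1"
    using assms by (intro product_length_refined_inverse) simp
  obtain C where "C > 0" and C: "\<And>\<epsilon> X' Z' V W. 0 \<le> \<epsilon> \<Longrightarrow> \<epsilon> < 1 \<Longrightarrow> admissible d \<epsilon> X' Z' V W \<Longrightarrow>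
      op_norm (refined_inverse d X' Z' V W * V - 1\<^sub>m d) \<le> C * \<epsilon>\<^sup>2"
    using refined_inverse_error_bound[of d] assms by auto
  show "\<exists>\<epsilon>\<^sub>0 > 0. \<exists>C > 0. \<forall>\<epsilon>. 0 \<le> \<epsilon> \<and> \<epsilon> < \<epsilon>\<^sub>0 \<longrightarrow>
      (\<forall>X' Z' V W. admissible d \<epsilon> X' Z' V W \<longrightarrow>
         op_norm (refined_inverse d X' Z' V W * V - 1\<^sub>m d) \<le> C * \<epsilon>\<^sup>2)"
    \<comment> \<open>The threshold 1 is the bound on \<epsilon> that made \<open>e\<close>
      bounded.\<close>
    using \<open>C > 0\<close> C by (intro exI[of _ "1 :: real"] exI[of _ C]) auto
qed

end
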